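(* Let $p$ be a prime, $p>3$, and let $c\in D_p$ with $c^2\not\equiv -3\pmod p$. Then \[ \sum_{k=0}^{p-1}\binom{3k}{k}\left(\frac{4}{9(c^2+3)}\right)^k\equiv \begin{cases} 1 \pmod{p}, & c\in C_0(p);\\ -\frac{1+c}{2c} \pmod{p}, & c\in C_1(p);\\ \frac{1-c}{2c} \pmod{p}, & c\in C_2(p), \end{cases} \qquad \sum_{k=0}^{p-1}C_k^{(2)}\left(\frac{4c^2}{27(c^2+3)}\right)^k\equiv \begin{cases} 1 \pmod{p}, & c\in C_0(p);\\ -\frac{9+c}{2c} \pmod{p}, & c\in C_1(p);\\ \frac{9-c}{2c} \pmod{p}, & c\in C_2(p). \end{cases} \]
   Context: $C_n^{(2)}=\frac{1}{2n+1}\binom{3n}{n}$. $D_p$ is the set of rationals whose denominator is not divisible by $p$. Let $\omega=e^{2\pi i/3}$ and $\mathbb{Z}[\omega]$ the Eisenstein integers, with norm $N(a+b\omega)=a^2-ab+b^2$. For a prime $\pi$ of $\mathbb{Z}[\omega]$ with $N(\pi)\neq 3$ and $\alpha\in\mathbb{Z}[\omega]$, $\left(\frac{\alpha}{\pi}\right)_3$ is $0$ if $\pi\mid\alpha$, and otherwise the unique $\omega^j$ with $\alpha^{(N(\pi)-1)/3}\equiv\omega^j\pmod{\pi}$. For a rational prime $p\equiv 2\pmod 3$, $p$ is prime in $\mathbb{Z}[\omega]$ and $\left(\frac{\alpha}{p}\right)_3$ is this character; for $p\equiv 1\pmod 3$, write $p=\pi\bar\pi$ with $\pi\equiv 2\pmod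 3$ and set $\left(\frac{\alpha}{p}\right)_3=\left(\frac{\alpha}{\pi}\right)_3\left(\frac{\alpha}{\bar\pi}\right)_3$. Elements of $D_p$ are reduced modulo these primes naturally. For $j\in\{0,1,2\}$, $C_j(p)=\{c\in D_p : \left(\frac{c+1+2\omega}{p}\right)_3=\omega^j\}$.
   Formalization: The first congruence is stated only for c not congruent to 0 mod p, since for c ≡ 0 one has c in C_0(p) but the sum is 1/9 mod p rather than 1 (e.g. p=5, c=0 gives 4); the second congruence is stated for all c. *)

theory Defs
  imports Complex_Main "HOL-Computational_Algebra.Primes"
begin

(* Eis a b stands for a + b * omega with omega = exp (2 * pi * i / 3); the embedding
   complex_of_eis below makes this identification precise. *)

datatype eisenstein = Eis (eis_fst: int) (eis_snd: int)

instantiation eisenstein :: comm_ring_1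
begin

definition zero_eisenstein :: eisenstein where "0 = Eis 0 0"
definition one_eisenstein :: eisenstein where "1 = Eis 1 0"

fun plus_eisenstein :: "eisenstein \<Rightarrow> eisenstein \<Rightarrow> eisenstein" where
  "Eis a b + Eis c d = Eis (a + c) (b + d)"

fun uminus_eisenstein :: "eisenstein \<Rightarrow> eisenstein" where
  "- Eis a b = Eis (- a) (- b)"

fun minus_eisenstein :: "eisenstein \<Rightarrow> eisenstein \<Rightarrow> eisenstein" where
  "Eis a b - Eis c d = Eis (a - c) (b - d)"

(* uses omega^2 = -1 - omega *)
fun times_eisenstein :: "eisenstein \<Rightarrow> eisenstein \<Rightarrow> eisenstein" where
  "Eis a b * Eis c d = Eis (a * c - b * d) (a * d + b * c - b * d)"

instance
proof
  fix x y z :: eisenstein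
  show "x * y * z = x * (y * z)"
    by (cases x; cases y; cases z) (simp add: algebra_simps)
  show "x * y = y * x"
    by (cases x; cases y) (simp add: algebra_simps)
  show "1 * x = x"
    by (cases x) (simp add: one_eisenstein_def)
  show "(x + y) * z = x * z + y * z"
    by (cases x; cases y; cases z) (simp add: algebra_simps)
  show "x + y + z = x + (y + z)"
    by (cases x; cases y; cases z) simp
  show "x + y = y + x"
    by (cases x; cases y) simp
  show "0 + x = x"
    by (cases x) (simp add: zero_eisenstein_def)
  show "- x + x = 0"
    by (cases x) (simp add: zero_eisenstein_def)
  show "x - y = x + - y"
    by (cases x; cases y) simp
  show "(0::eisenstein) \<noteq> 1"
    by (simp add: zero_eisenstein_def one_eisenstein_def)
qed

end

definition omega :: eisenstein where
  "omega = Eis 0 1"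

definition eis_norm :: "eisenstein \<Rightarrow> int" where
  "eis_norm x = (eis_fst x)^2 - eis_fst x * eis_snd x + (eis_snd x)^2"

(* complex conjugation: the conjugate of omega is -1 - omega *)
definition eis_cnj :: "eisenstein \<Rightarrow> eisenstein" where
  "eis_cnj x = Eis (eis_fst x - eis_snd x) (- eis_snd x)"

definition complex_of_eis :: "eisenstein \<Rightarrow> complex" where
  "complex_of_eis x = of_int (eis_fst x) + of_int (eis_snd x) * exp (2 * of_real pi * \<i> / 3)"

lemma exp_omega_eq: "exp (2 * of_real pi * \<i> / 3) = Complex (- (1/2)) (sqrt 3 / 2)"
proof -
  have "exp (2 * of_real pi * \<i> / 3) = cis (2 * pi / 3)"
    by (simp add: cis_conv_exp mult_ac)
  also have "\<dots> = Complex (- (1/2)) (sqrt 3 / 2)"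
    by (simp add: cis.code cos_120 sin_120)
  finally show ?thesis .
qed

lemma complex_of_eis_omega: "complex_of_eis omega = exp (2 * of_real pi * \<i> / 3)"
  by (simp add: complex_of_eis_def omega_def)

lemma complex_of_eis_0: "complex_of_eis 0 = 0"
  by (simp add: complex_of_eis_def zero_eisenstein_def)

lemma complex_of_eis_1: "complex_of_eis 1 = 1"
  by (simp add: complex_of_eis_def one_eisenstein_def)

lemma complex_of_eis_add: "complex_of_eis (x + y) = complex_of_eis x + complex_of_eis y"
  by (cases x; cases y) (simp add: complex_of_eis_def algebra_simps)

lemma complex_of_eis_mult: "complex_of_eis (x * y) = complex_of_eis x * complex_of_eis y"
  unfolding complex_of_eis_def exp_omega_eq
  by (cases x; cases y) (simp add: complex_eq_iff field_simps)

lemma complex_of_eis_cnj: "complex_of_eis (eis_cnj x) = cnj (complex_of_eis x)"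
  by (cases x) (simp add: complex_of_eis_def eis_cnj_def exp_omega_eq complex_eq_iff)

lemma complex_of_eis_inj: "inj complex_of_eis"
proof (rule injI)
  fix x y assume "complex_of_eis x = complex_of_eis y"
  then show "x = y"
    by (cases x; cases y) (auto simp: complex_of_eis_def exp_omega_eq complex_eq_iff)
qed

lemma eis_norm_cmod: "of_int (eis_norm x) = (cmod (complex_of_eis x))^2"
  unfolding complex_of_eis_def exp_omega_eq eis_norm_def cmod_power2
  by (cases x) (simp add: power2_eq_square field_simps)

(* Meaningful for an Eisenstein prime q of norm different from 3, where the exponent is
   exact and 1, omega, omega^2 are pairwise incongruent modulo q. *)
definition cubic_residue :: "eisenstein \<Rightarrow> eisenstein \<Rightarrow> eisenstein" where
  "cubic_residue x q =
     (if q dvd x then 0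
      else (THE z. z \<in> {omega ^ j |j. j < 3} \<and> q dvd (x ^ nat ((eis_norm q - 1) div 3) - z)))"

(* For a rational prime p different from 3. When p = 1 (mod 3), q is determined up to
   conjugation, under which the product is invariant. *)
definition rational_cubic_residue :: "eisenstein \<Rightarrow> nat \<Rightarrow> eisenstein" where
  "rational_cubic_residue x p =
     (if p mod 3 = 1
      then (let q = (SOME q. of_nat p = q * eis_cnj q \<and> 3 dvd (q - 2))
            in cubic_residue x q * cubic_residue x (eis_cnj q))
      else cubic_residue x (of_nat p))"

definition D_set :: "nat \<Rightarrow> rat set" where
  "D_set p = {x. \<not> int p dvd snd (quotient_of x)}"

definition rat_cong :: "nat \<Rightarrow> rat \<Rightarrow> rat \<Rightarrow> bool" where
  "rat_cong p x y \<longleftrightarrow> (\<exists>z \<in> D_set p. x - y = of_nat p * z)"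

definition rat_reduce :: "nat \<Rightarrow> rat \<Rightarrow> int" where
  "rat_reduce p x = (THE r. 0 \<le> r \<and> r < int p \<and> rat_cong p x (of_int r))"

definition C_set :: "nat \<Rightarrow> nat \<Rightarrow> rat set" where
  "C_set j p =
     {c \<in> D_set p. rational_cubic_residue (of_int (rat_reduce p c) + 1 + 2 * omega) p = omega ^ j}"

definition catalan2 :: "nat \<Rightarrow> rat" where
  "catalan2 n = 1 / of_nat (2 * n + 1) * of_nat ((3 * n) choose n)"

end

theory Submission
  imports Defs "HOL-Number_Theory.Number_Theory" "HOL-Computational_Algebra.Polynomial_FPS"
begin

text \<open>
  Modulo \<open>p\<close>, the sum of \<open>(3k choose k) x\<^sup>k\<close> over \<open>k < p\<close> is the coefficient of \<open>t\<^sup>p\<^sup>-\<^sup>1\<close> in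
  \<open>1 / ((1 + t)\<^sup>3 - Y t)\<close> with \<open>Y = 1 / x\<close>, that is, the term of index \<open>p + 1\<close> of a recurrence \<open>u\<close> with
  characteristic polynomial \<open>f(s) = (1 + s)\<^sup>3 - Y s\<^sup>2\<close>; since \<open>catalan2 k\<close> equals
  \<open>(3k choose k) - 2 (3k choose (k - 1))\<close>, the second sum is \<open>u (p + 1) - 2 u p\<close>.
  For \<open>4 Y = 9 (c\<^sup>2 + 3)\<close> the discriminant of \<open>f\<close> is a square. With \<open>\<theta>\<^sup>2 = - 3\<close>,
  \<open>\<lambda>(s) = 2 - (1 + \<theta> c) s\<close> and \<open>\<mu>(s) = 2 - (1 - \<theta> c) s\<close> one has
  \<open>16 c f = (c + \<theta>) \<lambda>\<^sup>3 + (c - \<theta>) \<mu>\<^sup>3\<close>, so raising \<open>(c + \<theta>) \<lambda>\<^sup>3 = - (c - \<theta>) \<mu>\<^sup>3\<close> to the power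
  \<open>(p - 1) / 3\<close> or \<open>(p + 1) / 3\<close> gives \<open>\<omega>\<^sup>j \<lambda>(s\<^sup>p) \<mu>(s) = \<mu>(s\<^sup>p) \<lambda>(s)\<close> modulo \<open>f\<close> and a prime above
  \<open>p\<close>, where \<open>\<omega>\<^sup>j\<close> is the cubic character of \<open>c + \<theta>\<close>. Reading this off on the recurrence yields a
  linear system for \<open>u p\<close>, \<open>u (p + 1)\<close>, \<open>u (p + 2)\<close>. The argument of the second sum arises from that of
  the first by \<open>c \<mapsto> 3 / c\<close>, which inverts the cubic character.
\<close>

section \<open>Congruences modulo an ideal with two generators\<close>

text \<open>In use \<open>f\<close> is the cubic in a polynomial ring over the Eisenstein integers
  and \<open>q\<close> a constant polynomial; this is equality in a quotient ring that is never
  formed.\<close>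

definition cong2 :: "'a::comm_ring_1 \<Rightarrow> 'a \<Rightarrow> 'a \<Rightarrow> 'a \<Rightarrow> bool" where
  "cong2 f q a b \<longleftrightarrow> (\<exists>u v. a - b = f * u + q * v)"

lemma cong2_refl [simp, intro]: "cong2 f q a a"
  unfolding cong2_def by (rule exI[of _ 0], rule exI[of _ 0]) simp

lemma cong2_sym: "cong2 f q a b \<Longrightarrow> cong2 f q b a"
proof -
  assume "cong2 f q a b"
  then obtain u v where "a - b = f * u + q * v"
    unfolding cong2_def by blast
  then have "b - a = f * (- u) + q * (- v)"
    by (metis minus_diff_eq mult_minus_right minus_add_distrib)
  then show ?thesis
    unfolding cong2_def by blast
qed

lemma cong2_add:
  assumes "cong2 f q a b" "cong2 f q c d"
  shows "cong2 f q (a + c) (b + d)"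
proof -
  obtain u v where 1: "a - b = f * u + q * v"
    using assms(1) unfolding cong2_def by blast
  obtain x y where 2: "c - d = f * x + q * y"
    using assms(2) unfolding cong2_def by blast
  have "(a + c) - (b + d) = (a - b) + (c - d)"
    by (simp add: algebra_simps)
  also have "\<dots> = f * (u + x) + q * (v + y)"
    unfolding 1 2 by (simp add: algebra_simps)
  finally show ?thesis
    unfolding cong2_def by blast
qed

lemma cong2_trans [trans]:
  assumes "cong2 f q a b" "cong2 f q b c"
  shows "cong2 f q a c"
proof -
  have "cong2 f q (a + b) (b + c)"
    using assms by (rule cong2_add)
  then show ?thesis
    unfolding cong2_def by (simp add: algebra_simps)
qed

lemma cong2_mult_left:
  assumes "cong2 f q a b"
  shows "cong2 f q (c * a) (c * b)"
proof -
  obtain u v where 1: "a - b = f * u + q * v"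
    using assms(1) unfolding cong2_def by blast
  have "c * a - c * b = c * (a - b)"
    by (simp add: algebra_simps)
  also have "\<dots> = f * (c * u) + q * (c * v)"
    unfolding 1 by (simp add: algebra_simps)
  finally show ?thesis
    unfolding cong2_def by blast
qed

lemma cong2_mult:
  assumes "cong2 f q a b" "cong2 f q c d"
  shows "cong2 f q (a * c) (b * d)"
proof -
  have "cong2 f q (c * a) (c * b)" "cong2 f q (b * c) (b * d)"
    using assms by (auto intro: cong2_mult_left)
  then show ?thesis
    by (metis cong2_trans mult.commute)
qed

lemma cong2_power: "cong2 f q a b \<Longrightarrow> cong2 f q (a ^ n) (b ^ n)"
  by (induction n) (auto intro: cong2_mult)

lemma cong2_diff:
  assumes "cong2 f q a b" "cong2 f q c d"
  shows "cong2 f q (a - c) (b - d)"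
  using cong2_add[OF assms(1) cong2_mult_left[OF assms(2), of "- 1"]] by simp

lemma cong2_of_dvd: "q dvd a - b \<Longrightarrow> cong2 f q a b"
proof -
  assume "q dvd a - b"
  then obtain v where "a - b = q * v" ..
  then have "a - b = f * 0 + q * v" by simp
  then show ?thesis unfolding cong2_def by blast
qed

lemma cong2_of_dvd_left: "f dvd a - b \<Longrightarrow> cong2 f q a b"
proof -
  assume "f dvd a - b"
  then obtain u where "a - b = f * u" ..
  then have "a - b = f * u + q * 0" by simp
  then show ?thesis unfolding cong2_def by blast
qed

section \<open>Congruences modulo a single element, as divisibility of differences\<close>

lemma dvd_diff_trans:
  fixes q :: "'a::comm_ring_1"
  shows "q dvd a - b \<Longrightarrow> q dvd b - c \<Longrightarrow> q dvd a - c"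
  using dvd_add[of q "a - b" "b - c"] by simp

lemma dvd_diff_sym:
  fixes q :: "'a::comm_ring_1"
  shows "q dvd a - b \<Longrightarrow> q dvd b - a"
  using dvd_minus_iff[of q "a - b"] by simp

lemma dvd_diff_mult:
  fixes q :: "'a::comm_ring_1"
  assumes "q dvd a - b" "q dvd c - d"
  shows "q dvd a * c - b * d"
proof -
  have "a * c - b * d = (a - b) * c + (c - d) * b"
    by (simp add: algebra_simps)
  then show ?thesis
    using assms by (metis dvd_add dvd_mult2)
qed

lemma dvd_diff_power:
  fixes q :: "'a::comm_ring_1"
  shows "q dvd a - b \<Longrightarrow> q dvd a ^ n - b ^ n"
  by (induction n) (auto intro: dvd_diff_mult)

section \<open>The Frobenius map\<close>

text \<open>The rings in use have characteristic 0, hence a divisibility by \<open>p\<close> in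
  place of an equation in characteristic \<open>p\<close>.\<close>

lemma prime_dvd_freshmans_dream:
  fixes x y :: "'a::comm_ring_1"
  assumes "prime p"
  shows "of_nat p dvd (x + y) ^ p - (x ^ p + y ^ p)"
proof -
  have p0: "p > 0" using assms by (simp add: prime_gt_0_nat)
  have "(x + y) ^ p = (\<Sum>k\<le>p. of_nat (p choose k) * x ^ k * y ^ (p - k))"
    by (rule binomial_ring)
  also have "{..p} = insert 0 (insert p {0<..<p})"
    using p0 by auto
  also have "(\<Sum>k\<in>\<dots>. of_nat (p choose k) * x ^ k * y ^ (p - k)) =
     x ^ p + y ^ p + (\<Sum>k\<in>{0<..<p}. of_nat (p choose k) * x ^ k * y ^ (p - k))"
    using p0 by (simp add: add_ac)
  finally have eq: "(x + y) ^ p - (x ^ p + y ^ p) =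
      (\<Sum>k\<in>{0<..<p}. of_nat (p choose k) * x ^ k * y ^ (p - k))"
    by simp
  have "of_nat p dvd (of_nat (p choose k) :: 'a)" if "k \<in> {0<..<p}" for k
  proof -
    have "p dvd p choose k"
      using that assms by (intro dvd_choose_prime) auto
    then show ?thesis by (metis dvd_def of_nat_mult)
  qed
  then show ?thesis
    unfolding eq by (intro dvd_sum) (auto simp: mult.assoc)
qed

lemma prime_dvd_power_minus_self_int:
  fixes a :: int
  assumes "prime p"
  shows "int p dvd a ^ p - a"
proof -
  have *: "int p dvd int n ^ p - int n" for n
  proof (induction n)
    case 0
    then show ?case using prime_gt_0_nat[OF assms] by (simp add: power_0_left)
  next
    case (Suc n)
    have "int p dvd (int n + 1) ^ p - (int n ^ p + 1 ^ p)"
      using prime_dvd_freshmans_dream[OF assms, of "int n" 1] by simp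
    from dvd_add[OF this Suc] show ?case by (simp add: algebra_simps)
  qed
  have "int p dvd a - a mod int p" by (simp add: minus_mod_eq_mult_div)
  moreover have "int p dvd (a mod int p) ^ p - a mod int p"
    using *[of "nat (a mod int p)"] prime_gt_0_nat[OF assms] by simp
  ultimately show ?thesis
    by (meson dvd_diff_power dvd_diff_sym dvd_diff_trans)
qed

section \<open>The Frobenius map permutes the roots of the cubic\<close>

text \<open>
  The cubic is written as a sum of two cubes of linear forms, the factors of its Hessian.
\<close>

lemma cubic_sum_of_cubes:
  fixes r Y \<theta> s :: "'a::comm_ring_1"
  assumes "\<theta>\<^sup>2 = - 3"
  shows "(r + \<theta>) * (2 - (1 + \<theta> * r) * s) ^ 3 + (r - \<theta>) * (2 - (1 - \<theta> * r) * s) ^ 3 =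
    16 * r * ((1 + s) ^ 3 - Y * s\<^sup>2) + (4 * Y - 9 * (r\<^sup>2 + 3)) * (4 * r * s\<^sup>2)"
proof -
  have *: "\<theta> * \<theta> = - 3" "\<And>x. \<theta> * (\<theta> * x) = - 3 * x"
    using assms by (simp_all add: power2_eq_square flip: mult.assoc)
  show ?thesis
    by (simp add: algebra_simps power2_eq_square power3_eq_cube *)
qed

text \<open>Modulo \<open>f\<close> and \<open>q\<close> the sum of the two cubes vanishes, so one
  term is minus the other; an even power removes the sign. As \<open>p\<close> is odd, both (p - 1)
  / 3 and (p + 1) / 3 are even when they are integers.\<close>

lemma cubic_factor_powers_cong:
  fixes r Y \<theta> s f q :: "'a::comm_ring_1"
  assumes \<theta>: "\<theta>\<^sup>2 = - 3"
    and f: "f = (1 + s) ^ 3 - Y * s\<^sup>2"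
    and Y: "cong2 f q (4 * Y) (9 * (r\<^sup>2 + 3))"
    and "even n"
  shows "cong2 f q ((r + \<theta>) ^ n * (2 - (1 + \<theta> * r) * s) ^ (3 * n))
                   ((r - \<theta>) ^ n * (2 - (1 - \<theta> * r) * s) ^ (3 * n))"
proof -
  define l where "l = 2 - (1 + \<theta> * r) * s"
  define m where "m = 2 - (1 - \<theta> * r) * s"
  have "cong2 f q ((r + \<theta>) * l ^ 3 + (r - \<theta>) * m ^ 3 - (r - \<theta>) * m ^ 3) (0 - (r - \<theta>) * m ^ 3)"
  proof (rule cong2_diff)
    have "cong2 f q (16 * r * f + (4 * Y - 9 * (r\<^sup>2 + 3)) * (4 * r * s\<^sup>2)) (0 + 0 * (4 * r * s\<^sup>2))"
      by (intro cong2_add cong2_mult cong2_refl)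
         (use cong2_diff[OF Y cong2_refl[of f q "9 * (r\<^sup>2 + 3)"]] in \<open>auto intro: cong2_of_dvd_left\<close>)
    then show "cong2 f q ((r + \<theta>) * l ^ 3 + (r - \<theta>) * m ^ 3) 0"
      unfolding l_def m_def cubic_sum_of_cubes[OF \<theta>, of r s Y] f by simp
  qed auto
  then have "cong2 f q ((r + \<theta>) * l ^ 3) ((- 1) * ((r - \<theta>) * m ^ 3))"
    by simp
  from cong2_power[OF this, of n]
  show ?thesis unfolding l_def[symmetric] m_def[symmetric]
    using \<open>even n\<close> by (simp add: power_mult_distrib power_mult)
qed

text \<open>Here \<open>z\<close> stands for s^p and Frobenius fixes the coefficients of the linear
  forms. There is no field to divide in, so \<open>v\<close> supplies the inverse of r -
  \<theta>.\<close>

lemma cubic_frobenius_relation_split: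
  fixes r Y \<theta> s z w f q :: "'a::comm_ring_1"
  assumes \<theta>: "\<theta>\<^sup>2 = - 3"
    and f: "f = (1 + s) ^ 3 - Y * s\<^sup>2"
    and Y: "cong2 f q (4 * Y) (9 * (r\<^sup>2 + 3))"
    and p: "p = 3 * n + 1" "even n"
    and lam: "cong2 f q ((2 - (1 + \<theta> * r) * s) ^ p) (2 - (1 + \<theta> * r) * z)"
    and mu: "cong2 f q ((2 - (1 - \<theta> * r) * s) ^ p) (2 - (1 - \<theta> * r) * z)"
    and w: "cong2 f q ((r + \<theta>) ^ n) (w * (r - \<theta>) ^ n)"
    and unit: "cong2 f q (v * (r - \<theta>)) 1"
  shows "cong2 f q (w * (2 - (1 + \<theta> * r) * z) * (2 - (1 - \<theta> * r) * s))
                   ((2 - (1 - \<theta> * r) * z) * (2 - (1 + \<theta> * r) * s))"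
proof -
  define l where "l = 2 - (1 + \<theta> * r) * s"
  define m where "m = 2 - (1 - \<theta> * r) * s"
  have 1: "cong2 f q ((r + \<theta>) ^ n * l ^ (3 * n)) ((r - \<theta>) ^ n * m ^ (3 * n))"
    unfolding l_def m_def by (rule cubic_factor_powers_cong[OF \<theta> f Y p(2)])
  have "cong2 f q ((w * (r - \<theta>) ^ n) * l ^ (3 * n)) ((r + \<theta>) ^ n * l ^ (3 * n))"
    by (intro cong2_mult cong2_refl) (use w cong2_sym in auto)
  from cong2_trans[OF this 1]
  \<comment> \<open>The factor l m raises the exponent 3 n to p = 3 n + 1 on either side;
    \<open>v ^ n\<close> is there to cancel (r - \<theta>)^n.\<close>
  have "cong2 f q ((l * m * v ^ n) * ((w * (r - \<theta>) ^ n) * l ^ (3 * n)))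
        ((l * m * v ^ n) * ((r - \<theta>) ^ n * m ^ (3 * n)))"
    by (rule cong2_mult_left)
  then have 2: "cong2 f q ((v * (r - \<theta>)) ^ n * (w * l ^ p * m)) ((v * (r - \<theta>)) ^ n * (m ^ p * l))"
    by (simp add: p(1) power_mult_distrib mult_ac)
  have 3: "cong2 f q ((v * (r - \<theta>)) ^ n) 1"
    using cong2_power[OF unit, of n] by simp
  have "cong2 f q (1 * (w * l ^ p * m)) (1 * (m ^ p * l))"
    by (rule cong2_trans[OF cong2_trans[OF _ 2]])
       (intro cong2_mult cong2_refl; use 3 in \<open>simp add: cong2_sym\<close>)+
  moreover have "cong2 f q (w * l ^ p * m) (w * (2 - (1 + \<theta> * r) * z) * m)"
    using lam by (intro cong2_mult cong2_refl) (simp add: l_def)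
  moreover have "cong2 f q (m ^ p * l) ((2 - (1 - \<theta> * r) * z) * l)"
    using mu by (intro cong2_mult cong2_refl) (simp add: m_def)
  ultimately show ?thesis
    unfolding l_def [symmetric] m_def [symmetric] by (metis cong2_sym cong2_trans mult_1)
qed

text \<open>Now Frobenius conjugates the coefficients and so exchanges the two linear forms, while 3
  n = p + 1 splits l^(3 n) as l^p l. The conclusion is the same as in the split case.\<close>

lemma cubic_frobenius_relation_inert:
  fixes r Y \<theta> s z w f q :: "'a::comm_ring_1"
  assumes \<theta>: "\<theta>\<^sup>2 = - 3"
    and f: "f = (1 + s) ^ 3 - Y * s\<^sup>2"
    and Y: "cong2 f q (4 * Y) (9 * (r\<^sup>2 + 3))"
    and p: "p + 1 = 3 * n" "even n"
    and lam: "cong2 f q ((2 - (1 + \<theta> * r) * s) ^ p) (2 - (1 - \<theta> * r) * z)"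
    and mu: "cong2 f q ((2 - (1 - \<theta> * r) * s) ^ p) (2 - (1 + \<theta> * r) * z)"
    and w: "cong2 f q ((r - \<theta>) ^ n) (w * (r + \<theta>) ^ n)"
    and unit: "cong2 f q (v * (r + \<theta>)) 1"
  shows "cong2 f q (w * (2 - (1 + \<theta> * r) * z) * (2 - (1 - \<theta> * r) * s))
                   ((2 - (1 - \<theta> * r) * z) * (2 - (1 + \<theta> * r) * s))"
proof -
  define l where "l = 2 - (1 + \<theta> * r) * s"
  define m where "m = 2 - (1 - \<theta> * r) * s"
  have 1: "cong2 f q ((r + \<theta>) ^ n * l ^ (3 * n)) ((r - \<theta>) ^ n * m ^ (3 * n))"
    unfolding l_def m_def by (rule cubic_factor_powers_cong[OF \<theta> f Y p(2)])
  have "cong2 f q ((r - \<theta>) ^ n * m ^ (3 * n)) ((w * (r + \<theta>) ^ n) * m ^ (3 * n))"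
    by (intro cong2_mult cong2_refl) (use w in auto)
  from cong2_trans[OF 1 this]
  have "cong2 f q (v ^ n * ((r + \<theta>) ^ n * l ^ (3 * n))) (v ^ n * (w * (r + \<theta>) ^ n * m ^ (3 * n)))"
    by (rule cong2_mult_left)
  then have 2: "cong2 f q ((v * (r + \<theta>)) ^ n * (l ^ p * l)) ((v * (r + \<theta>)) ^ n * (w * m ^ p * m))"
    unfolding p(1)[symmetric] by (simp add: power_mult_distrib mult_ac)
  have 3: "cong2 f q ((v * (r + \<theta>)) ^ n) 1"
    using cong2_power[OF unit, of n] by simp
  have "cong2 f q (1 * (l ^ p * l)) (1 * (w * m ^ p * m))"
    by (rule cong2_trans[OF cong2_trans[OF _ 2]])
       (intro cong2_mult cong2_refl; use 3 in \<open>simp add: cong2_sym\<close>)+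
  moreover have "cong2 f q (w * m ^ p * m) (w * (2 - (1 + \<theta> * r) * z) * m)"
    using mu by (intro cong2_mult cong2_refl) (simp add: m_def)
  moreover have "cong2 f q (l ^ p * l) ((2 - (1 - \<theta> * r) * z) * l)"
    using lam by (intro cong2_mult cong2_refl) (simp add: l_def)
  ultimately show ?thesis
    unfolding l_def [symmetric] m_def [symmetric] by (metis cong2_sym cong2_trans mult_1)
qed

section \<open>The recurrence attached to the cubic\<close>

text \<open>
  \<open>cubic_seq Y n\<close> is the coefficient of \<open>s\<^sup>2\<close> in the remainder of \<open>s\<^sup>n\<close> modulo \<open>(1 + s)\<^sup>3 - Y s\<^sup>2\<close>.
\<close>

fun cubic_seq :: "'a::comm_ring_1 \<Rightarrow> nat \<Rightarrow> 'a" where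
  "cubic_seq Y 0 = 0"
| "cubic_seq Y (Suc 0) = 0"
| "cubic_seq Y (Suc (Suc 0)) = 1"
| "cubic_seq Y (Suc (Suc (Suc n))) =
     (Y - 3) * cubic_seq Y (Suc (Suc n)) - 3 * cubic_seq Y (Suc n) - cubic_seq Y n"

lemma of_int_cubic_seq: "of_int (cubic_seq Y n) = cubic_seq (of_int Y) n"
  by (induction Y n rule: cubic_seq.induct) simp_all

section \<open>The linear functional on polynomials that sends the powers of the variable to a
  sequence\<close>

definition lin_eval :: "(nat \<Rightarrow> 'a::comm_ring_1) \<Rightarrow> 'a poly \<Rightarrow> 'a" where
  "lin_eval u P = (\<Sum>i\<le>degree P. coeff P i * u i)"

lemma lin_eval_altdef:
  assumes "degree P \<le> N"
  shows "lin_eval u P = (\<Sum>i\<le>N. coeff P i * u i)"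
  unfolding lin_eval_def using assms
  by (intro sum.mono_neutral_left) (auto simp: coeff_eq_0)

lemma lin_eval_add: "lin_eval u (P + Q) = lin_eval u P + lin_eval u Q"
proof -
  define N where "N = max (degree P) (degree Q)"
  have "degree (P + Q) \<le> N" "degree P \<le> N" "degree Q \<le> N"
    by (auto simp: N_def degree_add_le_max)
  then show ?thesis
    by (simp add: lin_eval_altdef sum.distrib ring_distribs)
qed

lemma lin_eval_const_mult: "lin_eval u ([:a:] * P) = a * lin_eval u P"
proof -
  have "degree ([:a:] * P) \<le> degree P"
    by (simp add: degree_smult_le)
  from lin_eval_altdef[OF this] show ?thesis
    by (simp add: lin_eval_def[of u P] sum_distrib_left mult.assoc)
qed

lemma lin_eval_diff: "lin_eval u (P - Q) = lin_eval u P - lin_eval u Q"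
  using lin_eval_add[of u P "[:- 1:] * Q"] lin_eval_const_mult[of u "- 1" Q] by simp

lemma lin_eval_X_mult: "lin_eval u ([:0, 1:] * P) = lin_eval (\<lambda>n. u (Suc n)) P"
proof -
  have "degree ([:0, 1:] * P) \<le> Suc (degree P)"
    by (simp add: degree_pCons_le)
  then have "lin_eval u ([:0, 1:] * P) = (\<Sum>i\<le>Suc (degree P). coeff ([:0, 1:] * P) i * u i)"
    by (rule lin_eval_altdef)
  also have "\<dots> = lin_eval (\<lambda>n. u (Suc n)) P"
    by (subst sum.atMost_Suc_shift) (simp add: lin_eval_def)
  finally show ?thesis .
qed

lemma lin_eval_X_power_mult:
  "lin_eval u ([:0, 1:] ^ n * P) = lin_eval (\<lambda>i. u (i + n)) P"
  by (induction n arbitrary: u) (simp_all only: power_Suc mult.assoc lin_eval_X_mult, simp_all)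

lemma lin_eval_const_X_power: "lin_eval u ([:a:] * [:0, 1:] ^ n) = a * u n"
proof -
  have "lin_eval (\<lambda>i. u (i + n)) 1 = u n"
    by (simp add: lin_eval_def)
  then show ?thesis
    unfolding lin_eval_const_mult using lin_eval_X_power_mult[of u n 1] by simp
qed

text \<open>The coefficients 1, 3, 3 - Y, 1 of the cubic are those of the recurrence, so the
  functional kills the ideal it generates.\<close>

lemma lin_eval_cubic_seq_eq_0:
  fixes Y :: "'a::comm_ring_1"
  defines "s \<equiv> [:0, 1:]"
  shows "lin_eval (cubic_seq Y) (((1 + s) ^ 3 - [:Y:] * s\<^sup>2) * P) = 0"
proof -
  let ?u = "cubic_seq Y"
  have "(((1 + s) ^ 3 - [:Y:] * s\<^sup>2) * P) =
     P + [:3:] * (s * P) + [:3 - Y:] * (s * (s * P)) + s * (s * (s * P))"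
    by (simp add: s_def power2_eq_square power3_eq_cube algebra_simps one_pCons numeral_poly)
  also have "lin_eval ?u \<dots> = lin_eval ?u P + 3 * lin_eval (\<lambda>n. ?u (Suc n)) P
      + (3 - Y) * lin_eval (\<lambda>n. ?u (Suc (Suc n))) P + lin_eval (\<lambda>n. ?u (Suc (Suc (Suc n)))) P"
    unfolding s_def by (simp only: lin_eval_add lin_eval_const_mult lin_eval_X_mult)
  also have "\<dots> = (\<Sum>i\<le>degree P. coeff P i * (?u i + 3 * ?u (Suc i) + (3 - Y) * ?u (Suc (Suc i))
       + ?u (Suc (Suc (Suc i)))))"
    by (simp only: lin_eval_def sum_distrib_left sum.distrib ring_distribs mult_ac)
  also have "\<dots> = 0"
    by (intro sum.neutral) (simp add: algebra_simps)
  finally show ?thesis .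
qed

lemma cong2_cubic_lin_eval:
  fixes Y :: "'a::comm_ring_1"
  assumes "cong2 ((1 + [:0, 1:]) ^ 3 - [:Y:] * [:0, 1:]\<^sup>2) [:q:] A B"
  shows "q dvd lin_eval (cubic_seq Y) A - lin_eval (cubic_seq Y) B"
proof -
  from assms obtain U V where "A - B = ((1 + [:0, 1:]) ^ 3 - [:Y:] * [:0, 1:]\<^sup>2) * U + [:q:] * V"
    unfolding cong2_def by blast
  then have "lin_eval (cubic_seq Y) (A - B) = q * lin_eval (cubic_seq Y) V"
    by (simp only: lin_eval_add lin_eval_const_mult lin_eval_cubic_seq_eq_0) simp
  then show ?thesis
    by (simp add: lin_eval_diff)
qed

text \<open>Multiply the polynomial congruence by s^i, expand and apply the functional.\<close>

lemma cubic_seq_bilinear: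
  fixes Y :: "'a::comm_ring_1"
  assumes "cong2 ((1 + [:0, 1:]) ^ 3 - [:Y:] * [:0, 1:]\<^sup>2) [:q:]
     ([:w:] * (2 - [:m:] * [:0, 1:] ^ p) * (2 - [:m':] * [:0, 1:]))
     ((2 - [:m':] * [:0, 1:] ^ p) * (2 - [:m:] * [:0, 1:]))"
  defines "u \<equiv> cubic_seq Y"
  shows "q dvd w * (4 * u i - 2 * m' * u (i + 1) - 2 * m * u (p + i) + m * m' * u (p + i + 1))
       - (4 * u i - 2 * m * u (i + 1) - 2 * m' * u (p + i) + m * m' * u (p + i + 1))"
proof -
  define s :: "'a poly" where "s = [:0, 1:]"
  have *: "lin_eval u (s ^ i * ([:w:] * (2 - [:m:] * s ^ p) * (2 - [:m':] * s)))
     = w * (4 * u i - 2 * m' * u (i + 1) - 2 * m * u (p + i) + m * m' * u (p + i + 1))" for w m m'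
  proof -
    have c: "[:a * b:] = [:a:] * [:b:]" "[:numeral k:] = numeral k" for a b :: 'a and k
      by (simp_all add: numeral_poly)
    have "s ^ i * ([:w:] * (2 - [:m:] * s ^ p) * (2 - [:m':] * s)) =
       [:4 * w:] * s ^ i - [:2 * w * m':] * s ^ (i + 1) - [:2 * w * m:] * s ^ (p + i)
       + [:w * m * m':] * s ^ (p + i + 1)"
      unfolding c mult.assoc by (simp add: algebra_simps power_add del: mult_pCons_left mult_pCons_right)
    also have "lin_eval u \<dots> = w * (4 * u i - 2 * m' * u (i + 1) - 2 * m * u (p + i) + m * m' * u (p + i + 1))"
      unfolding s_def
      by (simp only: lin_eval_add lin_eval_diff lin_eval_const_X_power) (simp add: algebra_simps)
    finally show ?thesis .
  qed
  \<comment> \<open>The second polynomial is the first with \<open>w = 1\<close> and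
    \<open>m\<close>, \<open>m'\<close> exchanged, so \<open>*\<close> evaluates both.\<close>
  have "q dvd lin_eval u (s ^ i * ([:w:] * (2 - [:m:] * s ^ p) * (2 - [:m':] * s)))
      - lin_eval u (s ^ i * ([:1:] * (2 - [:m':] * s ^ p) * (2 - [:m:] * s)))"
    unfolding u_def using assms(1)
    by (intro cong2_cubic_lin_eval cong2_mult_left) (simp add: s_def flip: one_pCons)
  then show ?thesis
    unfolding * by (simp add: mult_ac)
qed

section \<open>Binomial sums modulo \<open>p\<close>\<close>

text \<open>The polynomial is the reciprocal of the characteristic polynomial, whence Y t in place
  of Y s^2. The shift by 2 starts the series at the first nonzero term.\<close>

lemma cubic_seq_gen_fun:
  fixes Y :: "'a::comm_ring_1"
  shows "fps_of_poly ((1 + [:0, 1:]) ^ 3 - [:Y:] * [:0, 1:]) * Abs_fps (\<lambda>n. cubic_seq Y (n + 2)) = 1"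
    (is "_ * ?U = 1")
proof -
  have "fps_of_poly ((1 + [:0, 1:]) ^ 3 - [:Y:] * [:0, 1:]) =
      1 + fps_X * (fps_const (3 - Y) + fps_X * (fps_const 3 + fps_X))"
    by (simp add: fps_eq_iff coeff_pCons power3_eq_cube one_pCons algebra_simps split: nat.splits)
  moreover have "(1 + fps_X * (fps_const (3 - Y) + fps_X * (fps_const 3 + fps_X))) * ?U =
     ?U + fps_X * (fps_const (3 - Y) * ?U + fps_X * (fps_const 3 * ?U + fps_X * ?U))"
    by (simp add: algebra_simps)
  moreover have "\<dots> = 1"
  proof (rule fps_ext)
    fix n
    consider "n = 0" | "n = 1" | "n = 2" | k where "n = Suc (Suc (Suc k))"
      by (metis One_nat_def Suc_1 not0_implies_Suc)
    then show "fps_nth (?U + fps_X * (fps_const (3 - Y) * ?U + fps_X * (fps_const 3 * ?U + fps_X * ?U))) n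
        = fps_nth 1 n"
      by cases (simp_all add: numeral_2_eq_2 algebra_simps)
  qed
  ultimately show ?thesis by (simp only:)
qed

text \<open>\<open>G\<close> is the quotient (A^p - t^p) / (A - t) for A = X (1 + t)^3. Modulo p one
  has A^p = X (1 + t^p)^3, and multiplying by Y = 1 / X shows that ((1 + t)^3 - Y t) G is 1 modulo p
  and t^p.\<close>

lemma binomial_gen_fun_cong:
  fixes X Y :: int
  assumes "prime p" and XY: "int p dvd X * Y - 1"
  defines "G \<equiv> (\<Sum>k<p. [:0, 1:] ^ (p - Suc k) * ([:X:] * (1 + [:0, 1:]) ^ 3) ^ k)"
  assumes "n < p"
  shows "int p dvd coeff G n - cubic_seq Y (n + 2)"
proof -
  define t :: "int poly" where "t = [:0, 1:]"
  define P :: "int poly" where "P = of_nat p"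
  have "P dvd (1 + t) ^ p - (1 ^ p + t ^ p)"
    unfolding P_def by (rule prime_dvd_freshmans_dream[OF assms(1)])
  then have "P dvd ((1 + t) ^ p) ^ 3 - (1 + t ^ p) ^ 3"
    by (intro dvd_diff_power) simp
  moreover have "P dvd [:X:] ^ p - [:X:]"
  proof -
    from prime_dvd_power_minus_self_int[OF assms(1), of X]
    obtain h where "X ^ p - X = int p * h" ..
    then have "[:X:] ^ p - [:X:] = P * [:h:]"
      by (simp add: P_def of_nat_poly poly_const_pow)
    then show ?thesis ..
  qed
  ultimately have "P dvd [:X:] ^ p * ((1 + t) ^ p) ^ 3 - [:X:] * (1 + t ^ p) ^ 3"
    by (rule dvd_diff_mult[rotated])
  then obtain H1 where "[:X:] ^ p * ((1 + t) ^ p) ^ 3 - [:X:] * (1 + t ^ p) ^ 3 = P * H1" ..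
  then have H1: "[:X:] ^ p * ((1 + t) ^ p) ^ 3 = [:X:] * (1 + t ^ p) ^ 3 + P * H1"
    by (simp only: diff_eq_eq add.commute)
  obtain h where "X * Y - 1 = int p * h"
    using XY ..
  then have h: "[:Y:] * [:X:] = 1 + P * [:h:]"
    by (simp add: P_def of_nat_poly one_pCons algebra_simps)
  have "([:X:] * (1 + t) ^ 3 - t) * G = ([:X:] * (1 + t) ^ 3) ^ p - t ^ p"
    unfolding G_def t_def by (subst power_diff_sumr2) simp
  also have "([:X:] * (1 + t) ^ 3) ^ p = [:X:] ^ p * ((1 + t) ^ p) ^ 3"
    by (simp only: power_mult_distrib power_mult[symmetric] mult.commute)
  finally have "([:X:] * (1 + t) ^ 3 - t) * G = [:X:] * (1 + t ^ p) ^ 3 + P * H1 - t ^ p"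
    unfolding H1 .
  then have "[:Y:] * (([:X:] * (1 + t) ^ 3 - t) * G) = [:Y:] * ([:X:] * (1 + t ^ p) ^ 3 + P * H1 - t ^ p)"
    by simp
  then have "([:Y:] * [:X:] * (1 + t) ^ 3 - [:Y:] * t) * G =
      [:Y:] * [:X:] * (1 + t ^ p) ^ 3 + P * ([:Y:] * H1) - [:Y:] * t ^ p"
    by (simp only: algebra_simps)
  moreover obtain H where "(1 + t ^ p) ^ 3 = 1 + t ^ p * H"
  proof
    show "(1 + t ^ p) ^ 3 = 1 + t ^ p * (3 + t ^ p * (3 + t ^ p))"
      by (simp add: power3_eq_cube algebra_simps)
  qed
  ultimately have "((1 + t) ^ 3 - [:Y:] * t) * G =
     1 + t ^ p * (H - [:Y:]) + P * ([:h:] * (1 + t ^ p * H) + [:Y:] * H1 - [:h:] * (1 + t) ^ 3 * G)"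
    unfolding h by (simp add: algebra_simps)
  then obtain J K where JK: "((1 + t) ^ 3 - [:Y:] * t) * G = 1 + t ^ p * J + P * K"
    by blast
  define U where "U = Abs_fps (\<lambda>n. cubic_seq Y (n + 2))"
  \<comment> \<open>Power series let the cubic be inverted; the error term divisible by t^p does not
    reach the coefficient of index n < p.\<close>
  have "fps_of_poly G = (fps_of_poly ((1 + t) ^ 3 - [:Y:] * t) * U) * fps_of_poly G"
    unfolding U_def t_def cubic_seq_gen_fun by simp
  also have "\<dots> = fps_of_poly (((1 + t) ^ 3 - [:Y:] * t) * G) * U"
    by (simp only: fps_of_poly_mult mult_ac)
  also have "\<dots> = U + fps_X ^ p * (fps_of_poly J * U) + fps_const (int p) * (fps_of_poly K * U)"
    unfolding JK
    by (simp add: fps_of_poly_add fps_of_poly_mult fps_of_poly_power t_def P_def algebra_simps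
        of_nat_poly fps_of_poly_const)
  finally have "fps_nth (fps_of_poly G) n = fps_nth (U + fps_X ^ p * (fps_of_poly J * U) +
      fps_const (int p) * (fps_of_poly K * U)) n"
    by simp
  then have "coeff G n = cubic_seq Y (n + 2) + int p * fps_nth (fps_of_poly K * U) n"
    using \<open>n < p\<close> by (simp add: fps_X_power_mult_nth U_def)
  then show ?thesis by simp
qed

text \<open>The power t^(p - 1 - k) shifts the coefficient of t^(k - i) in (1 + t)^(3 k) to the
  common index p - 1 - i. The case distinction guards against truncated subtraction. Indices
  \<open>i = 0\<close> and \<open>i = 1\<close> serve the two sums.\<close>

lemma coeff_binomial_gen_fun:
  fixes X :: int
  assumes "i < p"
  shows "coeff (\<Sum>k<p. [:0, 1:] ^ (p - Suc k) * ([:X:] * (1 + [:0, 1:]) ^ 3) ^ k) (p - Suc i) =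
    (\<Sum>k<p. (if k < i then 0 else int (3 * k choose (k - i))) * X ^ k)"
  unfolding coeff_sum
proof (rule sum.cong)
  fix k assume "k \<in> {..<p}"
  then have k: "k < p" by simp
  have "[:0, 1:] ^ (p - Suc k) * ([:X:] * (1 + [:0, 1:]) ^ 3) ^ k =
      monom 1 (p - Suc k) * smult (X ^ k) ([:1, 1:] ^ (3 * k))"
    by (simp add: monom_altdef power_mult_distrib power_mult smult_power one_pCons)
  then show "coeff ([:0, 1:] ^ (p - Suc k) * ([:X:] * (1 + [:0, 1:]) ^ 3) ^ k) (p - Suc i) =
      (if k < i then 0 else int (3 * k choose (k - i))) * X ^ k"
    using k assms by (auto simp: coeff_monom_mult coeff_linear_poly_power)
qed auto

lemma binomial_sum_cong:
  fixes X Y :: int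
  assumes "prime p" and "int p dvd X * Y - 1" and "i < p"
  shows "int p dvd (\<Sum>k<p. (if k < i then 0 else int (3 * k choose (k - i))) * X ^ k)
    - cubic_seq Y (p + 1 - i)"
  using binomial_gen_fun_cong[OF assms(1,2), of "p - Suc i"] assms(3)
  unfolding coeff_binomial_gen_fun[OF assms(3)]
  by (simp add: Suc_diff_Suc flip: Suc_diff_le)

section \<open>Arithmetic of Eisenstein integers\<close>

lemma of_nat_eis: "of_nat n = Eis (int n) 0"
  by (induction n) (simp_all add: zero_eisenstein_def one_eisenstein_def)

lemma of_int_eis: "of_int n = Eis n 0"
  by (cases n rule: int_cases2) (simp_all add: of_nat_eis)

lemma numeral_eis: "numeral k = Eis (numeral k) 0"
  using of_int_eis[of "numeral k"] by simp

lemmas eis_simps = of_nat_eis of_int_eis numeral_eis zero_eisenstein_def one_eisenstein_def omega_def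
  eis_cnj_def eis_norm_def

lemma eis_cnj_add [simp]: "eis_cnj (x + y) = eis_cnj x + eis_cnj y"
  by (cases x; cases y) (simp add: eis_simps)

lemma eis_cnj_diff [simp]: "eis_cnj (x - y) = eis_cnj x - eis_cnj y"
  by (cases x; cases y) (simp add: eis_simps)

lemma eis_cnj_mult [simp]: "eis_cnj (x * y) = eis_cnj x * eis_cnj y"
  by (cases x; cases y) (simp add: eis_simps algebra_simps)

lemma eis_cnj_1 [simp]: "eis_cnj 1 = 1"
  by (simp add: eis_simps)

lemma eis_cnj_of_int [simp]: "eis_cnj (of_int n) = of_int n"
  by (simp add: eis_simps)

lemma eis_cnj_power [simp]: "eis_cnj (x ^ n) = eis_cnj x ^ n"
  by (induction n) simp_all

lemma eis_cnj_cnj [simp]: "eis_cnj (eis_cnj x) = x"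
  by (cases x) (simp add: eis_simps)

lemma eis_cnj_omega: "eis_cnj omega = omega ^ 2"
  by (simp add: eis_simps power2_eq_square)

lemma omega_cube: "omega ^ 3 = 1"
  by (simp add: eis_simps power3_eq_cube)

lemma omega_power_add_3 [simp]: "omega ^ (n + 3) = omega ^ n"
  by (simp add: power_add omega_cube)

lemma omega_power_mod_3: "omega ^ (n mod 3) = omega ^ n"
proof -
  have "omega ^ n = omega ^ (3 * (n div 3) + n mod 3)" by simp
  also have "\<dots> = omega ^ (n mod 3)"
    unfolding power_add power_mult omega_cube by simp
  finally show ?thesis ..
qed

lemma eis_mult_cnj: "x * eis_cnj x = of_int (eis_norm x)"
  by (cases x) (simp add: eis_simps power2_eq_square algebra_simps)

lemma eis_norm_mult: "eis_norm (x * y) = eis_norm x * eis_norm y"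
proof -
  have "of_int (eis_norm (x * y)) = (of_int (eis_norm x * eis_norm y) :: eisenstein)"
    by (simp add: eis_mult_cnj[symmetric] mult_ac)
  then show ?thesis by (simp add: eis_simps)
qed

lemma eis_cnj_dvd: "x dvd y \<Longrightarrow> eis_cnj x dvd eis_cnj y"
  by (auto elim!: dvdE)

lemma eis_dvd_cnj_iff: "eis_cnj x dvd y \<longleftrightarrow> x dvd eis_cnj y"
  using eis_cnj_dvd[of "eis_cnj x" y] eis_cnj_dvd[of x "eis_cnj y"] by auto

lemma of_nat_dvd_eis_iff: "of_nat p dvd Eis a b \<longleftrightarrow> int p dvd a \<and> int p dvd b"
proof
  assume "of_nat p dvd Eis a b"
  then obtain z where "Eis a b = of_nat p * z" ..
  then show "int p dvd a \<and> int p dvd b"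
    by (cases z) (simp add: eis_simps)
next
  assume "int p dvd a \<and> int p dvd b"
  then obtain x y where "a = int p * x" "b = int p * y"
    by (auto elim!: dvdE)
  then have "Eis a b = of_nat p * Eis x y"
    by (simp add: eis_simps)
  then show "of_nat p dvd Eis a b" ..
qed

text \<open>Fermat's congruence handles the two coordinates; \<open>omega ^ p\<close> is left as it
  is, to be reduced for either residue of \<open>p\<close> modulo 3.\<close>

lemma eis_frobenius:
  assumes "prime p"
  shows "of_nat p dvd x ^ p - (of_int (eis_fst x) + of_int (eis_snd x) * omega ^ p)"
proof -
  obtain a b where x: "x = Eis a b" by (cases x)
  have 1: "of_nat p dvd (of_int a + of_int b * omega) ^ p
     - ((of_int a) ^ p + (of_int b * omega) ^ p :: eisenstein)"
    by (rule prime_dvd_freshmans_dream[OF assms])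
  have fermat: "of_nat p dvd (of_int n ^ p - of_int n :: eisenstein)" for n
  proof -
    have "of_int n ^ p - of_int n = (of_int (n ^ p - n) :: eisenstein)"
      by simp
    also have "\<dots> = Eis (n ^ p - n) 0"
      by (rule of_int_eis)
    finally show ?thesis
      using prime_dvd_power_minus_self_int[OF assms] by (simp add: of_nat_dvd_eis_iff)
  qed
  have 2: "of_nat p dvd ((of_int a) ^ p + (of_int b * omega) ^ p)
        - (of_int a + of_int b * omega ^ p :: eisenstein)"
  proof -
    have "((of_int a) ^ p + (of_int b * omega) ^ p) - (of_int a + of_int b * omega ^ p :: eisenstein)
       = (of_int a ^ p - of_int a) + (of_int b ^ p - of_int b) * omega ^ p"
      by (simp add: algebra_simps power_mult_distrib)
    then show ?thesis
      using fermat[of a] fermat[of b] by (metis dvd_add dvd_mult2)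
  qed
  have "of_int a + of_int b * omega = x"
    by (simp add: x eis_simps)
  with dvd_diff_trans[OF 1 2] show ?thesis
    by (simp add: x)
qed

lemma eis_frobenius_split:
  fixes x :: eisenstein
  assumes "prime p" "p mod 3 = 1"
  shows "of_nat p dvd x ^ p - x"
proof -
  have "omega ^ p = omega"
    using omega_power_mod_3[of p] assms(2) by simp
  moreover have "of_int (eis_fst x) + of_int (eis_snd x) * omega = x"
    by (cases x) (simp add: eis_simps)
  ultimately show ?thesis
    using eis_frobenius[OF assms(1), of x] by simp
qed

lemma eis_frobenius_inert:
  assumes "prime p" "p mod 3 = 2"
  shows "of_nat p dvd x ^ p - eis_cnj x"
proof -
  have "omega ^ p = omega ^ 2"
    using omega_power_mod_3[of p] assms(2) by simp
  moreover have "of_int (eis_fst x) + of_int (eis_snd x) * omega ^ 2 = eis_cnj x"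
    by (cases x) (simp add: eis_simps power2_eq_square)
  ultimately show ?thesis
    using eis_frobenius[OF assms(1), of x] by simp
qed

section \<open>Prime elements above a rational prime\<close>

text \<open>Covers both an inert \<open>p\<close>, with \<open>q = p\<close>, and a factor
  \<open>q\<close> of a split \<open>p\<close>. Through \<open>dvd_norm\<close>, divisibility of a
  rational integer by \<open>q\<close> descends to divisibility by \<open>p\<close>.\<close>

locale eis_prime_above =
  fixes p :: nat and q :: eisenstein
  assumes prime_p: "prime p" and p_gt_3: "p > 3"
    and dvd_p: "q dvd of_nat p"
    and dvd_norm: "int p dvd eis_norm q"
    and prime_q: "q dvd x * y \<Longrightarrow> q dvd x \<or> q dvd y"
begin

lemma dvd_of_int_iff: "q dvd of_int n \<longleftrightarrow> int p dvd n"
proof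
  assume "q dvd of_int n"
  then obtain z where "of_int n = q * z" ..
  then have "eis_norm (of_int n) = eis_norm q * eis_norm z"
    by (simp add: eis_norm_mult)
  then have "int p dvd n ^ 2"
    using dvd_norm by (simp add: eis_simps)
  then show "int p dvd n"
    using prime_p by (metis prime_dvd_power prime_nat_int_transfer)
next
  assume "int p dvd n"
  then obtain k where "n = int p * k" ..
  then show "q dvd of_int n" using dvd_p by simp
qed

lemma not_dvd_3: "\<not> q dvd 3"
proof
  assume "q dvd 3"
  then have "int p dvd 3"
    using dvd_of_int_iff[of 3] by simp
  then show False
    using p_gt_3 zdvd_imp_le[of "int p" 3] by simp
qed

lemma not_dvd_1: "\<not> q dvd 1"
  using dvd_trans[of q 1 3] not_dvd_3 by auto

lemma prime_q_power: "q dvd x ^ n \<Longrightarrow> q dvd x"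
proof (induction n)
  case 0
  then show ?case using not_dvd_1 by simp
next
  case (Suc n)
  then show ?case using prime_q[of x "x ^ n"] by auto
qed

lemma dvd_cancel_3: "q dvd 3 * of_int n \<Longrightarrow> int p dvd n"
  using prime_q[of 3 "of_int n"] not_dvd_3 dvd_of_int_iff[of n] by simp

text \<open>A difference of two distinct cube roots of unity divides 3, which \<open>q\<close> does
  not divide.\<close>

lemma omega_power_cong_imp_eq:
  assumes "q dvd omega ^ i - omega ^ j"
  shows "omega ^ i = omega ^ j"
proof -
  have *: "i = j" if "q dvd omega ^ i - omega ^ j" "i < 3" "j < 3" "i \<le> j" for i j
  proof (rule ccontr)
    assume "i \<noteq> j"
    with that have "(i, j) \<in> {(0, 1), (0, 2), (1, 2)}" by auto
    \<comment> \<open>The cofactors come from 3 = (1 - \<omega>) (1 - \<omega>^2) = - (\<omega> -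
      \<omega>^2)^2.\<close>
    then have "omega ^ i - omega ^ j dvd 3"
    proof (elim insertE)
      assume "(i, j) = (0, 1)"
      then have "3 = (omega ^ i - omega ^ j) * (1 - omega ^ 2)"
        by (simp add: eis_simps power2_eq_square)
      then show ?thesis ..
    next
      assume "(i, j) = (0, 2)"
      then have "3 = (omega ^ i - omega ^ j) * (1 - omega)"
        by (simp add: eis_simps power2_eq_square)
      then show ?thesis ..
    next
      assume "(i, j) = (1, 2)"
      then have "3 = (omega ^ i - omega ^ j) * (omega ^ 2 - omega)"
        by (simp add: eis_simps power2_eq_square)
      then show ?thesis ..
    qed auto
    then show False
      using that(1) not_dvd_3 dvd_trans by blast
  qed
  have "i mod 3 = j mod 3"
  proof (cases "i mod 3 \<le> j mod 3")
    case True
    then show ?thesis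
      using assms by (intro *) (simp_all add: omega_power_mod_3)
  next
    case False
    then show ?thesis
      using dvd_diff_sym[OF assms] by (intro *[symmetric]) (simp_all add: omega_power_mod_3)
  qed
  then show ?thesis
    by (metis omega_power_mod_3)
qed

text \<open>Existence: y^3 - 1 splits into the factors y - \<omega>^i and \<open>q\<close> is prime.
  This makes the \<open>THE\<close> in \<open>cubic_residue\<close> meaningful.\<close>

lemma ex1_cubic_residue:
  assumes "q dvd x ^ (3 * n) - 1"
  shows "\<exists>!z. z \<in> {omega ^ j |j. j < 3} \<and> q dvd x ^ n - z"
proof (rule ex_ex1I)
  define y where "y = x ^ n"
  have "x ^ (3 * n) = y ^ 3"
    by (simp add: y_def mult.commute flip: power_mult)
  then have "x ^ (3 * n) - 1 = (y - omega ^ 0) * ((y - omega ^ 1) * (y - omega ^ 2))"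
    by (cases y) (simp add: eis_simps power2_eq_square power3_eq_cube algebra_simps)
  then have "q dvd (y - omega ^ 0) * ((y - omega ^ 1) * (y - omega ^ 2))"
    using assms by simp
  then consider "q dvd y - omega ^ 0" | "q dvd y - omega ^ 1" | "q dvd y - omega ^ 2"
    using prime_q by blast
  then obtain j where "j < 3" "q dvd y - omega ^ j"
    by cases (auto intro: that[of 0] that[of 1] that[of 2])
  then show "\<exists>z. z \<in> {omega ^ j |j. j < 3} \<and> q dvd x ^ n - z"
    unfolding y_def by blast
next
  fix z z' assume *: "z \<in> {omega ^ j |j. j < 3} \<and> q dvd x ^ n - z"
    "z' \<in> {omega ^ j |j. j < 3} \<and> q dvd x ^ n - z'"
  then have "q dvd z - z'"
    using dvd_diff_sym dvd_diff_trans by blast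
  then show "z = z'"
    using * omega_power_cong_imp_eq by blast
qed

text \<open>The exponent and Fermat's congruence enter as hypotheses because they differ in the
  split and inert cases.\<close>

lemma cubic_residue_cong:
  assumes "nat ((eis_norm q - 1) div 3) = n" and "\<not> q dvd x" and "q dvd x ^ (3 * n) - 1"
  shows "cubic_residue x q \<in> range ((^) omega)" "q dvd x ^ n - cubic_residue x q"
proof -
  let ?P = "\<lambda>z. z \<in> {omega ^ j |j. j < 3} \<and> q dvd x ^ n - z"
  have "cubic_residue x q = The ?P"
    unfolding cubic_residue_def assms(1) using assms(2) by (simp only: if_False)
  with theI'[OF ex1_cubic_residue[OF assms(3)]] have "?P (cubic_residue x q)"
    by simp
  then show "cubic_residue x q \<in> range ((^) omega)" "q dvd x ^ n - cubic_residue x q"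
    by blast+
qed

end

text \<open>Primality follows from multiplicativity of the norm once \<open>p\<close> dividing a
  norm is known to divide both coordinates, which is the inner fact \<open>norm\<close>.\<close>

lemma eis_prime_above_inert:
  assumes "prime p" "p > 3" "p mod 3 = 2"
  shows "eis_prime_above p (of_nat p)"
proof
  have norm: "int p dvd a \<and> int p dvd b" if "int p dvd a^2 - a * b + b^2" for a b
  proof -
    define n where "n = (p - 2) div 3"
    have n: "p = 3 * n + 2" using assms by (simp add: n_def) presburger
    have pp: "prime (int p)" using assms by simp
    have "odd p" using assms by (simp add: prime_odd_nat)
    then have "odd n" using n by simp
    have "a ^ 3 - (- b) ^ 3 = (a^2 - a * b + b^2) * (a + b)"
      by (simp add: algebra_simps power2_eq_square power3_eq_cube)
    then have "int p dvd a ^ 3 - (- b) ^ 3"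
      using that by simp
    from dvd_diff_power[OF this, of n] have "int p dvd a ^ (3 * n) - (- b) ^ (3 * n)"
      by (simp add: power_mult)
    \<comment> \<open>As \<open>n\<close> is odd, a^(3 n) = - b^(3 n) modulo p. The factor a^2 b^2
      completes the exponents to p = 3 n + 2, and Fermat then leaves a b (a + b).\<close>
    then have "int p dvd (a ^ (3 * n) + b ^ (3 * n)) * (a^2 * b^2)"
      using \<open>odd n\<close> by simp
    moreover have "(a ^ (3 * n) + b ^ (3 * n)) * (a^2 * b^2) = a ^ p * b^2 + b ^ p * a^2"
      by (simp add: n power_add algebra_simps power2_eq_square)
    ultimately have "int p dvd a ^ p * b^2 + b ^ p * a^2" by simp
    moreover have "int p dvd (a ^ p - a) * b^2 + (b ^ p - b) * a^2"
      by (intro dvd_add dvd_mult2 prime_dvd_power_minus_self_int assms)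
    ultimately have "int p dvd (a ^ p * b^2 + b ^ p * a^2) - ((a ^ p - a) * b^2 + (b ^ p - b) * a^2)"
      by (rule dvd_diff)
    then have "int p dvd a * b * (a + b)"
      by (simp add: algebra_simps power2_eq_square)
    then consider "int p dvd a" | "int p dvd b" | "int p dvd a + b"
      using pp by (auto simp: prime_dvd_mult_iff)
    then show ?thesis
    proof cases
      case 1
      then have "int p dvd (a^2 - a * b + b^2) - a * (a - b)"
        using that by (intro dvd_diff) auto
      then have "int p dvd b ^ 2" by (simp add: algebra_simps power2_eq_square)
      then show ?thesis using 1 pp prime_dvd_power by blast
    next
      case 2
      then have "int p dvd (a^2 - a * b + b^2) - b * (b - a)"
        using that by (intro dvd_diff) auto
      then have "int p dvd a ^ 2" by (simp add: algebra_simps power2_eq_square)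
      then show ?thesis using 2 pp prime_dvd_power by blast
    next
      case 3
      then have "int p dvd (a + b) * (a + b) - (a^2 - a * b + b^2)"
        using that by (intro dvd_diff) auto
      then have "int p dvd 3 * (a * b)" by (simp add: algebra_simps power2_eq_square)
      moreover have "\<not> int p dvd 3" using assms(2) by (auto dest: zdvd_imp_le)
      ultimately consider "int p dvd a" | "int p dvd b"
        using pp by (auto simp: prime_dvd_mult_iff)
      then show ?thesis
        using 3 by cases (simp_all add: dvd_add_right_iff dvd_add_left_iff)
    qed
  qed
  show "of_nat p dvd x \<or> of_nat p dvd y" if "of_nat p dvd x * y" for x y :: eisenstein
  proof -
    from that obtain z where "x * y = of_nat p * z" ..
    then have "eis_norm x * eis_norm y = eis_norm (of_nat p) * eis_norm z"
      by (simp flip: eis_norm_mult)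
    then have "int p dvd eis_norm x * eis_norm y"
      by (simp add: eis_simps power2_eq_square)
    then have "int p dvd eis_norm x \<or> int p dvd eis_norm y"
      using assms by (simp add: prime_dvd_mult_iff)
    moreover have "of_nat p dvd z" if "int p dvd eis_norm z" for z
      using norm[of "eis_fst z" "eis_snd z"] that
      by (cases z) (simp add: of_nat_dvd_eis_iff eis_norm_def)
    ultimately show ?thesis by blast
  qed
  show "int p dvd eis_norm (of_nat p)"
    by (simp add: of_nat_eis eis_norm_def power2_eq_square)
qed (use assms in auto)

text \<open>Every Eisenstein integer is congruent to a rational integer modulo \<open>q\<close>, so
  primality of \<open>q\<close> reduces to that of \<open>p\<close>.\<close>

lemma eis_prime_above_split:
  assumes "prime p" "p > 3" "of_nat p = q * eis_cnj q"
  shows "eis_prime_above p q"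
proof
  have pp: "prime (int p)" using assms by simp
  obtain a b where q: "q = Eis a b" by (cases q)
  have norm_q: "eis_norm q = int p"
    using assms(3) eis_mult_cnj[of q] by (simp add: eis_simps)
  then have ab: "a\<^sup>2 - a * b + b\<^sup>2 = int p"
    by (simp add: q eis_norm_def)
  have "\<not> int p dvd b"
  proof
    assume "int p dvd b"
    then have "int p dvd (a\<^sup>2 - a * b + b\<^sup>2) - b * (b - a)"
      unfolding ab by simp
    then have "int p dvd a ^ 2" by (simp add: algebra_simps power2_eq_square)
    then have "int p dvd a" using pp prime_dvd_power by blast
    with \<open>int p dvd b\<close> obtain x y where "a = int p * x" "b = int p * y"
      by (auto elim!: dvdE)
    \<comment> \<open>Otherwise p^2 would divide the norm p.\<close>
    then have "int p * (int p * (x^2 - x * y + y^2)) = int p * 1"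
      using ab by (simp add: power2_eq_square algebra_simps)
    then have "int p dvd 1"
      using assms(2) by (metis dvd_triv_left mult_cancel_left of_nat_0_eq_iff not_less0)
    then show False using assms(2) by simp
  qed
  then have "coprime b (int p)"
    using pp by (metis coprime_commute prime_imp_coprime)
  then obtain b' where b': "[b * b' = 1] (mod int p)"
    using cong_solve_coprime_int by blast
  have rep: "\<exists>n. q dvd x - of_int n" for x
  proof -
    obtain c d where x: "x = Eis c d" by (cases x)
    obtain k where k: "b * b' - 1 = int p * k"
      using b' by (auto simp: cong_iff_dvd_diff elim!: dvdE)
    \<comment> \<open>From q = a + b \<omega>, with \<open>b'\<close> inverse to \<open>b\<close>,
      one gets \<omega> = - a b' modulo q, whence the representative of c + d \<omega>.\<close>
    have "x - of_int (c - d * b' * a) = q * of_int (d * b') - of_nat p * (of_int (d * k) * omega)"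
    proof -
      have "d + int p * (d * k) = d * (b * b')"
        using k by (simp add: algebra_simps)
      then show ?thesis
        by (simp add: x q of_int_eis of_nat_eis omega_def algebra_simps)
    qed
    then have "q dvd x - of_int (c - d * b' * a)"
      unfolding assms(3) by (simp add: mult.assoc)
    then show ?thesis ..
  qed
  have int: "int p dvd n" if "q dvd of_int n" for n
  proof -
    from that obtain z where "of_int n = q * z" ..
    then have "eis_norm (of_int n) = eis_norm q * eis_norm z"
      by (simp add: eis_norm_mult)
    then have "int p dvd n ^ 2"
      using norm_q by (simp add: eis_simps)
    then show ?thesis using pp prime_dvd_power by blast
  qed
  show "q dvd x \<or> q dvd y" if "q dvd x * y" for x y
  proof -
    obtain m n where mn: "q dvd x - of_int m" "q dvd y - of_int n"
      using rep by blast
    then have "q dvd x * y - of_int m * of_int n"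
      by (rule dvd_diff_mult)
    then have "q dvd of_int (m * n)"
      using that by (metis dvd_diff_sym dvd_diff_trans diff_0_right of_int_mult)
    then have "int p dvd m \<or> int p dvd n"
      using int[of "m * n"] pp by (simp add: prime_dvd_mult_iff)
    moreover have "q dvd of_int n" if "int p dvd n" for n
      using that assms(3) by (auto elim!: dvdE simp: mult.assoc)
    ultimately show ?thesis
      using mn by (metis diff_add_cancel dvd_add)
  qed
  show "int p dvd eis_norm q" using norm_q by simp
qed (use assms in auto)

section \<open>Primes congruent to 1 modulo 3 as norms of Eisenstein integers congruent to 2 modulo
  3\<close>

lemma ex_primitive_cube_root_mod_prime:
  assumes "prime p" "p mod 3 = 1"
  shows "\<exists>w::int. int p dvd w\<^sup>2 + w + 1"
proof -
  define n where "n = (p - 1) div 3"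
  have n: "p = 3 * n + 1"
    using assms prime_gt_1_nat[OF assms(1)] unfolding n_def by presburger
  have "n > 0" using prime_gt_1_nat[OF assms(1)] n by auto
  obtain g where g: "residue_primroot p g"
    using prime_primitive_root_exists[of p] assms(1) prime_gt_1_nat[OF assms(1)] by auto
  then have "ord p g = p - 1"
    using assms(1) by (simp add: residue_primroot_def totient_prime)
  \<comment> \<open>The witness is g^((p - 1) / 3) for a primitive root \<open>g\<close>: its
    exponent is below the order of \<open>g\<close>, so it is not 1, but its cube is.\<close>
  then have "\<not> [g ^ n = 1] (mod p)"
    using n \<open>n > 0\<close> ord_divides[of g n p] by (auto dest: dvd_imp_le)
  moreover have "[g ^ (p - 1) = 1] (mod p)"
    using \<open>ord p g = p - 1\<close> by (metis dvd_refl ord_divides)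
  ultimately have 1: "\<not> int p dvd int g ^ n - 1" and 2: "int p dvd int g ^ (p - 1) - 1"
    by (metis cong_iff_dvd_diff cong_int_iff of_nat_1 of_nat_power)+
  have "int g ^ (p - 1) - 1 = (int g ^ n - 1) * ((int g ^ n)\<^sup>2 + int g ^ n + 1)"
    by (simp add: n algebra_simps power2_eq_square flip: power_add) (simp add: mult_2 mult.commute numeral_3_eq_3)
  with 1 2 have "int p dvd (int g ^ n)\<^sup>2 + int g ^ n + 1"
    using assms(1) by (simp add: prime_dvd_mult_iff)
  then show ?thesis by blast
qed

text \<open>With \<open>k\<close> the integer square root of \<open>p\<close> there are (k + 1)^2 >
  p pairs in the box; two of them agree in x - w y modulo p, and their difference is the small
  solution.\<close>

lemma thue_lemma:
  fixes p :: nat and w :: int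
  assumes "p > 0"
  shows "\<exists>x y. (x, y) \<noteq> (0, 0) \<and> x\<^sup>2 \<le> int p \<and> y\<^sup>2 \<le> int p \<and> int p dvd x - w * y"
proof -
  define k where "k = (LEAST k. p < (k + 1)\<^sup>2)"
  have "p < (p + 1)\<^sup>2" by (simp add: power2_eq_square)
  then have k1: "p < (k + 1)\<^sup>2"
    unfolding k_def by (rule LeastI)
  have k2: "k\<^sup>2 \<le> p"
  proof (cases k)
    case (Suc m)
    then have "\<not> p < (m + 1)\<^sup>2"
      unfolding k_def by (intro not_less_Least) auto
    then show ?thesis using Suc by simp
  qed auto
  define A where "A = {0..int k} \<times> {0..int k}"
  define f where "f = (\<lambda>(x, y). (x - w * y) mod int p)"
  have "finite A" by (simp add: A_def)
  have "f ` A \<subseteq> {0..<int p}"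
    using assms by (auto simp: f_def)
  then have "card (f ` A) \<le> card {0..<int p}"
    by (intro card_mono) auto
  also have "\<dots> < card A"
    using k1 by (simp add: A_def card_cartesian_product power2_eq_square nat_add_distrib)
  finally have "\<not> inj_on f A"
    using pigeonhole by blast
  then obtain x y x' y' where *: "(x, y) \<in> A" "(x', y') \<in> A" "(x, y) \<noteq> (x', y')" "f (x, y) = f (x', y')"
    unfolding inj_on_def by auto
  have bound: "(a - b)\<^sup>2 \<le> int p" if "a \<in> {0..int k}" "b \<in> {0..int k}" for a b
  proof -
    have "\<bar>a - b\<bar> \<le> \<bar>int k\<bar>" using that by auto
    then have "(a - b)\<^sup>2 \<le> (int k)\<^sup>2" by (simp only: abs_le_square_iff)
    also have "\<dots> \<le> int p" using k2 by (metis of_nat_mono of_nat_power)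
    finally show ?thesis .
  qed
  have "int p dvd (x - w * y) - (x' - w * y')"
    using *(4) by (simp add: f_def mod_eq_dvd_iff)
  then have "int p dvd (x - x') - w * (y - y')"
    by (simp add: algebra_simps)
  then show ?thesis
    using * bound by (intro exI[of _ "x - x'"] exI[of _ "y - y'"]) (auto simp: A_def)
qed

text \<open>A small Thue solution for a primitive cube root of unity gives a form value x^2 + x y +
  y^2 equal to p or 2 p. The value 2 p is impossible: an even value forces even x and y, hence is
  divisible by 4, while p is odd.\<close>

lemma ex_norm_eq_prime:
  assumes "prime p" "p mod 3 = 1"
  shows "\<exists>a b :: int. a\<^sup>2 - a * b + b\<^sup>2 = int p"
proof -
  obtain w :: int where w: "int p dvd w\<^sup>2 + w + 1"
    using ex_primitive_cube_root_mod_prime[OF assms] by blast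
  obtain x y where xy: "(x, y) \<noteq> (0, 0)" "x\<^sup>2 \<le> int p" "y\<^sup>2 \<le> int p" "int p dvd x - w * y"
    using thue_lemma[of p w] assms(1) prime_gt_0_nat by blast
  define N where "N = x\<^sup>2 + x * y + y\<^sup>2"
  have "N = (x - w * y) * (x + w * y + y) + y\<^sup>2 * (w\<^sup>2 + w + 1)"
    by (simp add: N_def algebra_simps power2_eq_square)
  then have "int p dvd N"
    using w xy(4) by simp
  then obtain c where c: "N = int p * c" ..
  have nsq: "z\<^sup>2 \<noteq> int p" for z
  proof
    assume "z\<^sup>2 = int p"
    then have "prime (z\<^sup>2)" using assms(1) by simp
    then show False by (simp add: prime_power_iff)
  qed
  have "4 * N = (2 * x + y)\<^sup>2 + 3 * y\<^sup>2" "4 * N = (2 * y + x)\<^sup>2 + 3 * x\<^sup>2"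
    by (simp_all add: N_def algebra_simps power2_eq_square)
  moreover have "x\<^sup>2 > 0 \<or> y\<^sup>2 > 0" using xy(1) by auto
  ultimately have "N > 0"
    using zero_le_power2[of "2 * x + y"] zero_le_power2[of "2 * y + x"] by linarith
  have "0 \<le> (x - y)\<^sup>2" by simp
  then have "2 * (x * y) \<le> x\<^sup>2 + y\<^sup>2"
    by (simp add: algebra_simps power2_eq_square)
  \<comment> \<open>No square equals p, so both Thue bounds are strict.\<close>
  then have "N < 3 * int p"
    using xy nsq[of x] nsq[of y] unfolding N_def by linarith
  have "c > 0" using \<open>N > 0\<close> c by (simp add: zero_less_mult_iff)
  moreover have "c < 3"
    using \<open>N < 3 * int p\<close> c prime_gt_0_nat[OF assms(1)] by (simp add: mult.commute)
  ultimately have "c = 1 \<or> c = 2" by auto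
  moreover have "c \<noteq> 2"
  proof
    assume "c = 2"
    then have "even N" using c by simp
    then have "even x" "even y"
      by (auto simp: N_def)
    then obtain u v where "x = 2 * u" "y = 2 * v" by (auto elim!: evenE)
    then have "2 * (2 * (u\<^sup>2 + u * v + v\<^sup>2)) = 2 * int p"
      using c \<open>c = 2\<close> by (simp add: N_def power2_eq_square algebra_simps)
    then have "even (int p)" by presburger
    then have "p = 2"
      using assms(1) by (metis even_of_nat primes_dvd_imp_eq two_is_prime_nat)
    then show False using assms(2) by simp
  qed
  ultimately have "x\<^sup>2 - x * (- y) + (- y)\<^sup>2 = int p"
    using c by (simp add: N_def)
  then show ?thesis by blast
qed

lemma three_dvd_eis_iff: "3 dvd Eis a b \<longleftrightarrow> 3 dvd a \<and> 3 dvd b"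
  using of_nat_dvd_eis_iff[of 3 a b] by simp

text \<open>Guarantees that the \<open>SOME\<close> in \<open>rational_cubic_residue\<close> has a
  witness. Among q, \<omega> q, \<omega>^2 q one has its second coordinate divisible by 3, and a
  sign then makes the first one 2 modulo 3.\<close>

lemma ex_primary_factor:
  assumes "prime p" "p mod 3 = 1"
  shows "\<exists>q. of_nat p = q * eis_cnj q \<and> 3 dvd (q - 2)"
proof -
  obtain a b where ab: "a\<^sup>2 - a * b + b\<^sup>2 = int p"
    using ex_norm_eq_prime[OF assms] by blast
  have mod3: "int p mod 3 = 1"
    using assms(2) by (metis of_nat_1 of_nat_mod of_nat_numeral)
  have main: ?thesis if "a\<^sup>2 - a * b + b\<^sup>2 = int p" "3 dvd b" for a b
  proof -
    have "\<not> 3 dvd a"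
    proof
      assume "3 dvd a"
      then have "3 dvd a\<^sup>2 - a * b + b\<^sup>2"
        using that(2) by (simp add: power2_eq_square)
      then show False using that(1) mod3 by (simp add: dvd_eq_mod_eq_0)
    qed
    then have "3 dvd a - 2 \<or> 3 dvd - a - 2" by presburger
    then obtain s :: int where s: "s * s = 1" "3 dvd s * a - 2"
    proof
      assume "3 dvd a - 2"
      then show ?thesis by (intro that[of 1]) simp_all
    next
      assume "3 dvd - a - 2"
      then show ?thesis by (intro that[of "- 1"]) simp_all
    qed
    define q where "q = Eis (s * a) (s * b)"
    have "eis_norm q = s * s * (a\<^sup>2 - a * b + b\<^sup>2)"
      by (simp add: q_def eis_norm_def power2_eq_square algebra_simps)
    then have "of_nat p = q * eis_cnj q"
      using s(1) that(1) by (simp add: eis_mult_cnj)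
    moreover have "3 dvd q - 2"
      using s(2) that(2) by (simp add: q_def numeral_eis[of "num.Bit0 num.One"] three_dvd_eis_iff)
    ultimately show ?thesis by blast
  qed
  have "3 dvd b \<or> 3 dvd a \<or> 3 dvd a - b"
  proof -
    \<comment> \<open>Modulo 3 the norm is (a + b)^2.\<close>
    have "\<not> 3 dvd a + b"
    proof
      assume "3 dvd a + b"
      then have "3 dvd (a + b) * (a + b) - 3 * (a * b)"
        by (intro dvd_diff) auto
      also have "(a + b) * (a + b) - 3 * (a * b) = int p"
        using ab by (simp add: algebra_simps power2_eq_square)
      finally show False using mod3 by (simp add: dvd_eq_mod_eq_0)
    qed
    then show ?thesis by presburger
  qed
  then consider "3 dvd b" | "3 dvd - a" | "3 dvd a - b" by auto
  then show ?thesis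
  proof cases
    case 1
    then show ?thesis using ab main by blast
  next
    case 2
    \<comment> \<open>The coordinates of \<omega>^2 q; the third case uses those of \<omega>
      q.\<close>
    have "(b - a)\<^sup>2 - (b - a) * (- a) + (- a)\<^sup>2 = int p"
      using ab by (simp add: algebra_simps power2_eq_square)
    then show ?thesis using main 2 by blast
  next
    case 3
    have "(- b)\<^sup>2 - (- b) * (a - b) + (a - b)\<^sup>2 = int p"
      using ab by (simp add: algebra_simps power2_eq_square)
    then show ?thesis using main 3 by blast
  qed
qed

section \<open>Cubic characters of \<open>r + 1 + 2 \<omega>\<close>\<close>

definition eis_sqrt_m3 :: eisenstein where
  "eis_sqrt_m3 = 1 + 2 * omega"

lemma eis_sqrt_m3_square: "eis_sqrt_m3\<^sup>2 = - 3"
  by (simp add: eis_sqrt_m3_def eis_simps power2_eq_square)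

lemma eis_cnj_sqrt_m3 [simp]: "eis_cnj eis_sqrt_m3 = - eis_sqrt_m3"
  by (simp add: eis_sqrt_m3_def eis_simps)

text \<open>
  The rational cubic character of \<open>r + \<theta>\<close> is \<open>\<omega>\<^sup>j\<close>. For \<open>p = 1\<close> modulo 3 it is the
  \<open>(p - 1) / 3\<close>-th power of \<open>(r + \<theta>) / (r - \<theta>)\<close> modulo \<open>q\<close>; for \<open>p = 2\<close> modulo 3 the Frobenius map is
  conjugation, so it is the \<open>(p + 1) / 3\<close>-th power of \<open>(r - \<theta>) / (r + \<theta>)\<close>.
\<close>

definition cubic_type :: "nat \<Rightarrow> eisenstein \<Rightarrow> nat \<Rightarrow> int \<Rightarrow> bool" where
  "cubic_type p q j r \<longleftrightarrow> (\<exists>n. even n \<and>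
     (p = 3 * n + 1 \<and>
        q dvd (of_int r + eis_sqrt_m3) ^ n - omega ^ j * (of_int r - eis_sqrt_m3) ^ n \<or>
      p + 1 = 3 * n \<and>
        q dvd (of_int r - eis_sqrt_m3) ^ n - omega ^ j * (of_int r + eis_sqrt_m3) ^ n))"

lemma cubic_residue_nonzeroD: "cubic_residue x q \<noteq> 0 \<Longrightarrow> \<not> q dvd x"
  by (auto simp: cubic_residue_def)

lemma omega_power_nonzero: "omega ^ j \<noteq> 0"
proof
  assume "omega ^ j = 0"
  then have "omega ^ (3 * j) = 0"
    by (metis mult.commute power_0_left power_mult zero_neq_numeral)
  then show False
    by (simp add: power_mult omega_cube)
qed

text \<open>The character is x^e with e = (p^2 - 1) / 3 = (p - 1) n. Multiplying by x^n turns it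
  into (x^p)^n, and x^p is the conjugate of x.\<close>

lemma cubic_type_of_residue_inert:
  assumes "prime p" "p > 3" "p mod 3 = 2"
    and res: "cubic_residue (of_int r + eis_sqrt_m3) (of_nat p) = omega ^ j"
  shows "cubic_type p (of_nat p) j r"
proof -
  interpret eis_prime_above p "of_nat p"
    by (rule eis_prime_above_inert[OF assms(1-3)])
  define x where "x = of_int r + eis_sqrt_m3"
  have cnj_x: "eis_cnj x = of_int r - eis_sqrt_m3"
    by (simp add: x_def)
  define n where "n = (p + 1) div 3"
  have n: "p + 1 = 3 * n" using assms(3) unfolding n_def by presburger
  have "odd p" using assms by (simp add: prime_odd_nat)
  then have "even n" using n by (metis even_mult_iff even_plus_one_iff odd_numeral)
  define e where "e = (p - 1) * n"
  have e: "3 * e + 1 = p * p"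
  proof -
    have "3 * e + 1 = (p - 1) * (p + 1) + 1" by (simp only: e_def n mult_ac)
    also have "\<dots> = p * p" using assms(2) by (simp add: algebra_simps)
    finally show ?thesis .
  qed
  have "eis_norm (of_nat p) - 1 = int e * 3"
    using e by (simp add: of_nat_eis eis_norm_def power2_eq_square flip: of_nat_mult)
  then have 1: "nat ((eis_norm (of_nat p) - 1) div 3) = e"
    by simp
  have 2: "\<not> of_nat p dvd x"
    using res omega_power_nonzero by (intro cubic_residue_nonzeroD) (simp add: x_def)
  have F: "of_nat p dvd y ^ p - eis_cnj y" for y
    by (rule eis_frobenius_inert[OF assms(1,3)])
  have 3: "of_nat p dvd x ^ (3 * e) - 1"
  proof -
    \<comment> \<open>Applying Frobenius twice gives x^(p^2) = x modulo p.\<close>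
    have "of_nat p dvd (x ^ p) ^ p - eis_cnj x ^ p"
      by (intro dvd_diff_power F)
    moreover have "of_nat p dvd eis_cnj x ^ p - x"
      using F[of "eis_cnj x"] by simp
    ultimately have "of_nat p dvd x ^ (p * p) - x"
      unfolding power_mult by (rule dvd_diff_trans)
    then have "of_nat p dvd x * (x ^ (3 * e) - 1)"
      by (simp add: e[symmetric] algebra_simps)
    then show ?thesis using prime_q[of x "x ^ (3 * e) - 1"] 2 by simp
  qed
  have "of_nat p dvd x ^ e - omega ^ j"
    using cubic_residue_cong(2)[OF 1 2 3] res by (simp add: x_def)
  then have "of_nat p dvd x ^ e * x ^ n - omega ^ j * x ^ n"
    by (intro dvd_diff_mult) auto
  moreover have "x ^ e * x ^ n = (x ^ p) ^ n"
  proof -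
    have "e + n = p * n" unfolding e_def using assms(2) by (simp add: algebra_simps)
    then show ?thesis by (metis power_add power_mult)
  qed
  ultimately have "of_nat p dvd (x ^ p) ^ n - omega ^ j * x ^ n"
    by simp
  moreover have "of_nat p dvd eis_cnj x ^ n - (x ^ p) ^ n"
    by (intro dvd_diff_sym[OF dvd_diff_power] F)
  ultimately have "of_nat p dvd eis_cnj x ^ n - omega ^ j * x ^ n"
    using dvd_diff_trans by blast
  then show ?thesis
    unfolding cubic_type_def using n \<open>even n\<close> by (auto simp: cnj_x x_def)
qed

text \<open>Conjugating the congruence modulo the conjugate of \<open>q\<close> yields one modulo
  \<open>q\<close> with inverse root of unity. The product of the two residues thus becomes a
  quotient of n-th powers modulo \<open>q\<close>.\<close>

lemma cubic_type_of_residue_split: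
  assumes "prime p" "p > 3" "p mod 3 = 1" and q: "of_nat p = q * eis_cnj q"
    and res: "cubic_residue (of_int r + eis_sqrt_m3) q *
      cubic_residue (of_int r + eis_sqrt_m3) (eis_cnj q) = omega ^ j"
  shows "cubic_type p q j r"
proof -
  interpret eis_prime_above p q
    by (rule eis_prime_above_split[OF assms(1,2) q])
  interpret cnj: eis_prime_above p "eis_cnj q"
    by (rule eis_prime_above_split[OF assms(1,2)]) (simp add: q mult.commute)
  define x where "x = of_int r + eis_sqrt_m3"
  have cnj_x: "eis_cnj x = of_int r - eis_sqrt_m3"
    by (simp add: x_def)
  define n where "n = (p - 1) div 3"
  have n: "p = 3 * n + 1" using assms(2,3) unfolding n_def by presburger
  have "odd p" using assms by (simp add: prime_odd_nat)
  then have "even n" using n by simp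
  have norm_q: "eis_norm q = int p" "eis_norm (eis_cnj q) = int p"
    using q eis_mult_cnj[of q] eis_mult_cnj[of "eis_cnj q"]
    by (simp_all add: of_nat_eis of_int_eis mult.commute)
  have 1: "nat ((eis_norm q - 1) div 3) = n" "nat ((eis_norm (eis_cnj q) - 1) div 3) = n"
    by (simp_all add: norm_q n)
  have 2: "\<not> q dvd x" "\<not> eis_cnj q dvd x"
    using res omega_power_nonzero[of j] by (auto intro!: cubic_residue_nonzeroD simp: x_def)
  have "of_nat p dvd x ^ p - x"
    by (rule eis_frobenius_split[OF assms(1,3)])
  then have p_dvd: "of_nat p dvd x * (x ^ (3 * n) - 1)"
    by (simp add: n algebra_simps)
  then have 3: "q dvd x ^ (3 * n) - 1" "eis_cnj q dvd x ^ (3 * n) - 1"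
    using prime_q[of x "x ^ (3 * n) - 1"] cnj.prime_q[of x "x ^ (3 * n) - 1"] 2
      dvd_trans[OF dvd_p p_dvd] dvd_trans[OF cnj.dvd_p p_dvd] by simp_all
  obtain a b where ab: "cubic_residue x q = omega ^ a" "cubic_residue x (eis_cnj q) = omega ^ b"
    using cubic_residue_cong(1)[OF 1(1) 2(1) 3(1)] cnj.cubic_residue_cong(1)[OF 1(2) 2(2) 3(2)]
    by auto
  have a: "q dvd x ^ n - omega ^ a"
    using cubic_residue_cong(2)[OF 1(1) 2(1) 3(1)] ab by simp
  have "eis_cnj q dvd x ^ n - omega ^ b"
    using cnj.cubic_residue_cong(2)[OF 1(2) 2(2) 3(2)] ab by simp
  then have "q dvd eis_cnj x ^ n - omega ^ (2 * b)"
    by (simp add: eis_dvd_cnj_iff eis_cnj_omega power_mult)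
  then have "q dvd omega ^ j * eis_cnj x ^ n - omega ^ j * omega ^ (2 * b)"
    by (intro dvd_diff_mult) auto
  moreover have "omega ^ j * omega ^ (2 * b) = omega ^ a"
  proof -
    have "omega ^ j = omega ^ a * omega ^ b"
      using res ab by (simp add: x_def)
    then have "omega ^ j * omega ^ (2 * b) = omega ^ a * (omega ^ 3) ^ b"
      by (simp add: power_add[symmetric] power_mult[symmetric] add.commute)
    then show ?thesis by (simp add: omega_cube)
  qed
  ultimately have "q dvd omega ^ j * eis_cnj x ^ n - omega ^ a"
    by simp
  from dvd_diff_trans[OF a dvd_diff_sym[OF this]]
  have "q dvd x ^ n - omega ^ j * eis_cnj x ^ n" .
  then show ?thesis
    unfolding cubic_type_def using n \<open>even n\<close> by (auto simp: cnj_x x_def)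
qed

lemma ex_cubic_type:
  assumes "prime p" "p > 3"
    and res: "rational_cubic_residue (of_int r + 1 + 2 * omega) p = omega ^ j"
  shows "\<exists>q. eis_prime_above p q \<and> cubic_type p q j r"
proof -
  have "p mod 3 \<noteq> 0"
    using assms(1,2) prime_nat_iff[of p] by (auto simp flip: dvd_eq_mod_eq_0)
  then consider "p mod 3 = 1" | "p mod 3 = 2" by linarith
  then show ?thesis
  proof cases
    case 1
    define q where "q = (SOME q. of_nat p = q * eis_cnj q \<and> 3 dvd (q - 2))"
    have q: "of_nat p = q * eis_cnj q"
      unfolding q_def using someI_ex[OF ex_primary_factor[OF assms(1) 1]] by blast
    have "cubic_residue (of_int r + eis_sqrt_m3) q *
      cubic_residue (of_int r + eis_sqrt_m3) (eis_cnj q) = omega ^ j"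
      using res 1 by (simp add: rational_cubic_residue_def q_def Let_def eis_sqrt_m3_def add.assoc)
    then show ?thesis
      using cubic_type_of_residue_split[OF assms(1,2) 1 q] eis_prime_above_split[OF assms(1,2) q]
      by blast
  next
    case 2
    have "cubic_residue (of_int r + eis_sqrt_m3) (of_nat p) = omega ^ j"
      using res 2 by (simp add: rational_cubic_residue_def eis_sqrt_m3_def add.assoc)
    then show ?thesis
      using cubic_type_of_residue_inert[OF assms(1,2) 2] eis_prime_above_inert[OF assms(1,2) 2]
      by blast
  qed
qed

section \<open>The cubic type at r = 0 and under r -> 3 / r\<close>

context eis_prime_above
begin

lemma not_dvd_sqrt_m3: "\<not> q dvd eis_sqrt_m3"
proof
  assume "q dvd eis_sqrt_m3"
  then have "q dvd eis_sqrt_m3\<^sup>2" by (simp add: power2_eq_square)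
  then show False using not_dvd_3 by (simp add: eis_sqrt_m3_square)
qed

text \<open>Since \<open>n\<close> is even, \<theta>^n and (- \<theta>)^n agree and can be
  cancelled. This excludes classes 1 and 2 when c is 0 modulo p.\<close>

lemma cubic_type_0:
  assumes "cubic_type p q j 0"
  shows "omega ^ j = 1"
proof -
  from assms obtain n where "even n" "q dvd eis_sqrt_m3 ^ n - omega ^ j * eis_sqrt_m3 ^ n"
    by (auto simp: cubic_type_def)
  then have "q dvd eis_sqrt_m3 ^ n * (omega ^ 0 - omega ^ j)"
    by (simp add: right_diff_distrib mult.commute)
  then have "q dvd omega ^ 0 - omega ^ j"
    using prime_q[of "eis_sqrt_m3 ^ n" "omega ^ 0 - omega ^ j"] prime_q_power[of eis_sqrt_m3 n]
      not_dvd_sqrt_m3 by blast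
  then show ?thesis
    using omega_power_cong_imp_eq[of 0 j] by simp
qed

text \<open>
  Up to a factor \<open>\<theta> / r\<close> or \<open>- \<theta> / r\<close>, the substitution \<open>r \<mapsto> 3 / r\<close> exchanges \<open>r + \<theta>\<close> and
  \<open>r - \<theta>\<close>.
\<close>

lemma cubic_type_3_div:
  assumes rr': "int p dvd r * r' - 3" and "cubic_type p q j r"
  shows "cubic_type p q (2 * j) r'"
proof -
  define x where "x = of_int r + eis_sqrt_m3"
  define y where "y = of_int r - eis_sqrt_m3"
  define x' where "x' = of_int r' + eis_sqrt_m3"
  define y' where "y' = of_int r' - eis_sqrt_m3"
  have m3: "eis_sqrt_m3 * eis_sqrt_m3 = - 3"
    using eis_sqrt_m3_square by (simp add: power2_eq_square)
  have q3: "q dvd of_int (r * r' - 3)"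
    using rr' dvd_of_int_iff by blast
  have X: "q dvd of_int r * x' - eis_sqrt_m3 * y"
  proof -
    have "of_int r * x' - eis_sqrt_m3 * y = of_int (r * r' - 3)"
      by (simp add: x'_def y_def algebra_simps m3)
    then show ?thesis using q3 by simp
  qed
  have Y: "q dvd of_int r * y' - (- eis_sqrt_m3) * x"
  proof -
    have "of_int r * y' - (- eis_sqrt_m3) * x = of_int (r * r' - 3)"
      by (simp add: y'_def x_def algebra_simps m3)
    then show ?thesis using q3 by simp
  qed
  have r: "\<not> q dvd of_int r"
  proof
    assume "q dvd of_int r"
    then have "q dvd of_int r * of_int r' - of_int (r * r' - 3)"
      using q3 by (intro dvd_diff) auto
    then show False using not_dvd_3 by simp
  qed
  \<comment> \<open>Stated for general \<open>u\<close>, \<open>v\<close>, \<open>t\<close> to serve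
    both alternatives, with t = \<theta> or - \<theta>. Exchanging the two powers inverts
    \<omega>^j, and the inverse is \<omega>^(2 j).\<close>
  have *: "q dvd u' ^ n - omega ^ (2 * j) * v' ^ n"
    if "even n" "q dvd u ^ n - omega ^ j * v ^ n"
      "q dvd of_int r * u' - t * v" "q dvd of_int r * v' - (- t) * u" for u v u' v' t n
  proof -
    have U: "q dvd of_int r ^ n * u' ^ n - t ^ n * v ^ n"
      using dvd_diff_power[OF that(3), of n] by (simp add: power_mult_distrib)
    have V: "q dvd of_int r ^ n * v' ^ n - t ^ n * u ^ n"
      using dvd_diff_power[OF that(4), of n] \<open>even n\<close> by (simp add: power_mult_distrib)
    have "q dvd omega ^ (2 * j) * (of_int r ^ n * v' ^ n) - omega ^ (2 * j) * (t ^ n * u ^ n)"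
      by (intro dvd_diff_mult V) auto
    moreover have "q dvd omega ^ (2 * j) * (t ^ n * u ^ n)
        - omega ^ (2 * j) * (t ^ n * (omega ^ j * v ^ n))"
      by (intro dvd_diff_mult that(2)) auto
    moreover have "omega ^ (2 * j) * (t ^ n * (omega ^ j * v ^ n)) = t ^ n * v ^ n"
    proof -
      have "omega ^ (2 * j) * (t ^ n * (omega ^ j * v ^ n)) = (omega ^ 3) ^ j * (t ^ n * v ^ n)"
        by (simp add: power_mult power3_eq_cube power2_eq_square power_mult_distrib mult_ac)
      then show ?thesis by (simp add: omega_cube)
    qed
    ultimately have "q dvd omega ^ (2 * j) * (of_int r ^ n * v' ^ n) - t ^ n * v ^ n"
      using dvd_diff_trans by metis
    from dvd_diff_trans[OF U dvd_diff_sym[OF this]]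
    have "q dvd of_int r ^ n * u' ^ n - omega ^ (2 * j) * (of_int r ^ n * v' ^ n)" .
    then have "q dvd of_int r ^ n * (u' ^ n - omega ^ (2 * j) * v' ^ n)"
      by (simp add: algebra_simps)
    then show ?thesis
      using prime_q[of "of_int r ^ n" "u' ^ n - omega ^ (2 * j) * v' ^ n"]
        prime_q_power[of "of_int r" n] r by blast
  qed
  from assms(2) obtain n where n: "even n" and cases:
    "p = 3 * n + 1 \<and> q dvd x ^ n - omega ^ j * y ^ n \<or> p + 1 = 3 * n \<and> q dvd y ^ n - omega ^ j * x ^ n"
    unfolding cubic_type_def x_def y_def by blast
  from cases have "p = 3 * n + 1 \<and> q dvd x' ^ n - omega ^ (2 * j) * y' ^ n \<or>
      p + 1 = 3 * n \<and> q dvd y' ^ n - omega ^ (2 * j) * x' ^ n"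
    using *[OF n, of x y x' eis_sqrt_m3 y'] *[OF n, of y x y' "- eis_sqrt_m3" x'] X Y by auto
  then show ?thesis
    unfolding cubic_type_def x'_def y'_def using n by blast
qed

end

section \<open>Solving for the values of the recurrence\<close>

lemma const_poly_dvd_diff:
  fixes a b q :: "'a::comm_ring_1"
  assumes "q dvd a - b"
  shows "[:q:] dvd [:a:] - [:b:]"
proof -
  from assms obtain k where "a - b = q * k" ..
  then have "[:a:] - [:b:] = [:q:] * [:k:]" by simp
  then show ?thesis ..
qed

text \<open>Cramer's rule for the three relations, with the cofactors of the column of
  \<open>u1\<close>. The factor 4 and the subtracted multiple replace Y by 9 (r^2 + 3) / 4.\<close>

lemma cubic_system_cofactors_1:
  fixes D b r Y u0 u1 u2 :: int
  shows "4 * ((- (D * D)) * (D * u1 - b * u0) + (- b * (D * (Y - 3) - b)) * (D * u2 - b * u1 - 2 * (1 - r)) + b * D * (D * ((Y - 3) * u2 - 3 * u1 - u0) - b * u2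
      - 2 * (1 - r) * (Y - 3) + 4))
     - (4 * Y - 9 * (r\<^sup>2 + 3)) * (b\<^sup>2 * D * u1)
     = (b\<^sup>2 * (D * (9 * (r\<^sup>2 + 3) - 12) - 4 * b) - 12 * b * D\<^sup>2 - 4 * D ^ 3) * u1
       - 8 * b * ((1 - r) * b - 2 * D)"
  by Groebner_Basis.algebra

text \<open>The same elimination with the cofactors of the column of \<open>u0\<close>.\<close>

lemma cubic_system_cofactors_0:
  fixes D b r Y u0 u1 u2 :: int
  shows "4 * ((3 * D\<^sup>2 - b * (D * (Y - 3) - b)) * (D * u1 - b * u0) + (- D * (D * (Y - 3) - b)) * (D * u2 - b * u1 - 2 * (1 - r)) + D\<^sup>2 * (D * ((Y - 3) * u2 - 3 * u1 - u0) - b * u2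
      - 2 * (1 - r) * (Y - 3) + 4))
     - (4 * Y - 9 * (r\<^sup>2 + 3)) * (b\<^sup>2 * D * u0)
     = (b\<^sup>2 * (D * (9 * (r\<^sup>2 + 3) - 12) - 4 * b) - 12 * b * D\<^sup>2 - 4 * D ^ 3) * u0
       - 8 * D * ((1 - r) * b - 2 * D)"
  by Groebner_Basis.algebra

context eis_prime_above
begin

lemma odd_p: "odd p"
  using prime_p p_gt_3 by (simp add: prime_odd_nat)

text \<open>In use \<open>m'\<close> is \<open>m\<close> itself or its conjugate, according to
  \<open>p\<close> modulo 3.\<close>

lemma linear_poly_frobenius:
  assumes "q dvd m ^ p - m'"
  shows "[:q:] dvd (2 - [:m:] * [:0, 1:]) ^ p - (2 - [:m':] * [:0, 1:] ^ p)"
proof -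
  define s :: "eisenstein poly" where "s = [:0, 1:]"
  have "[:q:] dvd of_nat p"
    using const_poly_dvd_diff[of q "of_nat p" 0] dvd_p by (simp add: of_nat_poly)
  moreover have "of_nat p dvd (2 + (- [:m:] * s)) ^ p - (2 ^ p + (- [:m:] * s) ^ p)"
    by (rule prime_dvd_freshmans_dream[OF prime_p])
  ultimately have "[:q:] dvd (2 + (- [:m:] * s)) ^ p - (2 ^ p + (- [:m:] * s) ^ p)"
    using dvd_trans by blast
  moreover have "(- [:m:] * s) ^ p = - ([:m ^ p:] * s ^ p)"
    by (simp only: mult_minus_left power_minus_odd[OF odd_p] power_mult_distrib poly_const_pow)
  ultimately have 1: "[:q:] dvd (2 - [:m:] * s) ^ p - (2 ^ p - [:m ^ p:] * s ^ p)"
    by simp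
  have "q dvd 2 ^ p - 2"
    using prime_dvd_power_minus_self_int[OF prime_p, of 2] dvd_of_int_iff[of "2 ^ p - 2"] by simp
  from const_poly_dvd_diff[OF this] have "[:q:] dvd 2 ^ p - 2"
    by (simp add: numeral_poly poly_const_pow)
  moreover have "[:q:] dvd [:m ^ p:] * s ^ p - [:m':] * s ^ p"
    by (intro dvd_diff_mult const_poly_dvd_diff assms) auto
  ultimately have "[:q:] dvd (2 ^ p - 2) - ([:m ^ p:] * s ^ p - [:m':] * s ^ p)"
    by (rule dvd_diff)
  then have "[:q:] dvd (2 ^ p - [:m ^ p:] * s ^ p) - (2 - [:m':] * s ^ p)"
    by (simp only: algebra_simps)
  from dvd_diff_trans[OF 1 this] show ?thesis
    unfolding s_def .
qed

text \<open>Both types lead to one polynomial congruence: Frobenius fixes \<open>m\<close> and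
  \<open>m'\<close> in the split case and exchanges them in the inert case.\<close>

lemma cubic_seq_relation:
  assumes type: "cubic_type p q j r" and r: "\<not> int p dvd r\<^sup>2 + 3"
    and Y: "int p dvd 4 * Y - 9 * (r\<^sup>2 + 3)"
  defines "u \<equiv> \<lambda>i. of_int (cubic_seq Y i)"
    and "m \<equiv> 1 + eis_sqrt_m3 * of_int r" and "m' \<equiv> 1 - eis_sqrt_m3 * of_int r"
  shows "q dvd omega ^ j * (4 * u i - 2 * m' * u (i + 1) - 2 * m * u (p + i) + m * m' * u (p + i + 1))
       - (4 * u i - 2 * m * u (i + 1) - 2 * m' * u (p + i) + m * m' * u (p + i + 1))"
proof -
  define s :: "eisenstein poly" where "s = [:0, 1:]"
  define f where "f = (1 + s) ^ 3 - [:of_int Y:] * s\<^sup>2"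
  define R :: "eisenstein poly" where "R = [:of_int r:]"
  define \<theta> where "\<theta> = [:eis_sqrt_m3:]"
  have *: "cong2 f [:q:] [:a:] [:b:]" if "q dvd a - b" for a b
    using that by (intro cong2_of_dvd const_poly_dvd_diff)
  have \<theta>: "\<theta>\<^sup>2 = - 3"
    using eis_sqrt_m3_square by (simp add: \<theta>_def power2_eq_square numeral_poly)
  have Y': "cong2 f [:q:] (4 * [:of_int Y:]) (9 * (R\<^sup>2 + 3))"
  proof -
    have "q dvd of_int (4 * Y) - of_int (9 * (r\<^sup>2 + 3))"
      using Y dvd_of_int_iff by (simp only: flip: of_int_diff)
    from *[OF this] show ?thesis
      by (simp add: R_def power2_eq_square numeral_poly mult.commute)
  qed
  have m: "1 + \<theta> * R = [:m:]" "1 - \<theta> * R = [:m':]"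
    by (simp_all add: \<theta>_def R_def m_def m'_def one_pCons)
  have cnj_m: "eis_cnj m = m'" "eis_cnj m' = m"
    by (simp_all add: m_def m'_def)
  \<comment> \<open>An inverse \<open>k\<close> of the norm r^2 + 3 yields the inverses k (r -
    \<theta>) of r + \<theta> and k (r + \<theta>) of r - \<theta>.\<close>
  have "coprime (r\<^sup>2 + 3) (int p)"
    using r prime_p by (metis coprime_commute prime_imp_coprime prime_nat_int_transfer)
  then obtain k where "[(r\<^sup>2 + 3) * k = 1] (mod int p)"
    using cong_solve_coprime_int by blast
  then have k: "q dvd of_int ((r\<^sup>2 + 3) * k - 1)"
    by (simp only: dvd_of_int_iff cong_iff_dvd_diff)
  have norm: "(of_int r - eis_sqrt_m3) * (of_int r + eis_sqrt_m3) = of_int (r\<^sup>2 + 3)"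
    using eis_sqrt_m3_square by (simp add: algebra_simps power2_eq_square)
  have v1: "cong2 f [:q:] ([:of_int k * (of_int r - eis_sqrt_m3):] * (R + \<theta>)) 1"
  proof -
    have "of_int k * (of_int r - eis_sqrt_m3) * (of_int r + eis_sqrt_m3) - 1 = of_int ((r\<^sup>2 + 3) * k - 1)"
      unfolding mult.assoc norm by (simp add: mult.commute del: of_int_add)
    with k have "q dvd of_int k * (of_int r - eis_sqrt_m3) * (of_int r + eis_sqrt_m3) - 1" by simp
    from *[OF this] show ?thesis by (simp add: R_def \<theta>_def one_pCons mult_ac)
  qed
  have v2: "cong2 f [:q:] ([:of_int k * (of_int r + eis_sqrt_m3):] * (R - \<theta>)) 1"
  proof -
    have "of_int k * (of_int r + eis_sqrt_m3) * (of_int r - eis_sqrt_m3) - 1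
        = of_int k * ((of_int r - eis_sqrt_m3) * (of_int r + eis_sqrt_m3)) - 1"
      by (simp add: mult_ac)
    also have "\<dots> = of_int ((r\<^sup>2 + 3) * k - 1)"
      by (simp add: norm mult.commute del: of_int_add)
    finally have "q dvd of_int k * (of_int r + eis_sqrt_m3) * (of_int r - eis_sqrt_m3) - 1"
      using k by simp
    from *[OF this] show ?thesis by (simp add: R_def \<theta>_def one_pCons mult_ac)
  qed
  have *: "cong2 f [:q:] ((2 - [:a:] * s) ^ p) (2 - [:b:] * s ^ p)" if "q dvd a ^ p - b" for a b
    unfolding s_def using that by (intro cong2_of_dvd linear_poly_frobenius)
  from type obtain n where "even n" and n:
     "p = 3 * n + 1 \<and> q dvd (of_int r + eis_sqrt_m3) ^ n - omega ^ j * (of_int r - eis_sqrt_m3) ^ n \<or>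
      p + 1 = 3 * n \<and> q dvd (of_int r - eis_sqrt_m3) ^ n - omega ^ j * (of_int r + eis_sqrt_m3) ^ n"
    unfolding cubic_type_def by blast
  from n have "cong2 f [:q:] ([:omega ^ j:] * (2 - [:m:] * s ^ p) * (2 - [:m':] * s))
                   ((2 - [:m':] * s ^ p) * (2 - [:m:] * s))"
  proof (elim disjE conjE)
    assume p: "p = 3 * n + 1"
      and "q dvd (of_int r + eis_sqrt_m3) ^ n - omega ^ j * (of_int r - eis_sqrt_m3) ^ n"
    then have "cong2 f [:q:] [:(of_int r + eis_sqrt_m3) ^ n:] [:omega ^ j * (of_int r - eis_sqrt_m3) ^ n:]"
      by (intro cong2_of_dvd const_poly_dvd_diff)
    then have w: "cong2 f [:q:] ((R + \<theta>) ^ n) ([:omega ^ j:] * (R - \<theta>) ^ n)"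
      by (simp add: R_def \<theta>_def poly_const_pow mult.commute)
    have "p mod 3 = 1" using p by presburger
    then have F: "q dvd x ^ p - x" for x
      using eis_frobenius_split[OF prime_p] dvd_p dvd_trans by blast
    show ?thesis
      using cubic_frobenius_relation_split[OF \<theta> f_def Y' p \<open>even n\<close> _ _ w v2, unfolded m, OF * *] F
      by simp
  next
    assume p: "p + 1 = 3 * n"
      and "q dvd (of_int r - eis_sqrt_m3) ^ n - omega ^ j * (of_int r + eis_sqrt_m3) ^ n"
    then have "cong2 f [:q:] [:(of_int r - eis_sqrt_m3) ^ n:] [:omega ^ j * (of_int r + eis_sqrt_m3) ^ n:]"
      by (intro cong2_of_dvd const_poly_dvd_diff)
    then have w: "cong2 f [:q:] ((R - \<theta>) ^ n) ([:omega ^ j:] * (R + \<theta>) ^ n)"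
      by (simp add: R_def \<theta>_def poly_const_pow mult.commute)
    have "p mod 3 = 2" using p by presburger
    then have F: "q dvd x ^ p - eis_cnj x" for x
      using eis_frobenius_inert[OF prime_p] dvd_p dvd_trans by blast
    show ?thesis
      using cubic_frobenius_relation_inert[OF \<theta> f_def Y' p \<open>even n\<close> _ _ w v1, unfolded m, OF * *]
        F[of m] F[of m'] by (simp add: cnj_m)
  qed
  then show ?thesis
    unfolding f_def s_def u_def of_int_cubic_seq by (rule cubic_seq_bilinear)
qed

lemma prime_dvd_mult_cancel_int:
  fixes a b :: int
  assumes "int p dvd a * b" "\<not> int p dvd a"
  shows "int p dvd b"
  using assms prime_p by (simp add: prime_dvd_mult_iff)

lemma not_dvd_2_power: "\<not> int p dvd 2 ^ k"
proof
  assume "int p dvd 2 ^ k"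
  then have "int p dvd 2"
    using prime_p prime_dvd_power by (metis prime_nat_int_transfer)
  then show False
    using p_gt_3 zdvd_imp_le[of "int p" 2] by simp
qed

text \<open>For trivial character the outer terms of the relation cancel and 4 \<theta> r times the
  difference of the middle terms remains; a factor - \<theta> makes this rational.\<close>

lemma cubic_seq_type_0:
  assumes "cubic_type p q 0 r" and "\<not> int p dvd r\<^sup>2 + 3" and "\<not> int p dvd r"
    and "int p dvd 4 * Y - 9 * (r\<^sup>2 + 3)"
  shows "int p dvd cubic_seq Y (p + i) - cubic_seq Y (i + 1)"
proof -
  let ?u = "cubic_seq Y"
  have "q dvd 4 * eis_sqrt_m3 * of_int r * (of_int (?u (i + 1)) - of_int (?u (p + i)))"
    using cubic_seq_relation[OF assms(1,2,4), of i] by (simp add: algebra_simps)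
  from dvd_mult[OF this, of "- eis_sqrt_m3"]
  have "q dvd - (eis_sqrt_m3\<^sup>2) * (4 * of_int r * (of_int (?u (i + 1)) - of_int (?u (p + i))))"
    by (simp add: power2_eq_square mult_ac)
  then have "q dvd 3 * of_int (2\<^sup>2 * (r * (?u (i + 1) - ?u (p + i))))"
    unfolding eis_sqrt_m3_square by (simp add: mult_ac)
  then have "int p dvd 2\<^sup>2 * (r * (?u (i + 1) - ?u (p + i)))"
    by (rule dvd_cancel_3)
  then have "int p dvd ?u (i + 1) - ?u (p + i)"
    using prime_dvd_mult_cancel_int not_dvd_2_power assms(3) by blast
  then show ?thesis by (rule dvd_diff_sym)
qed

text \<open>The relation reads \<omega> A = B with B conjugate to A. The factor \<omega>^2 - 1 turns
  it into (1 - \<omega>) A + (1 - \<omega>^2) B, a sum of conjugates and so a rational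
  integer.\<close>

lemma cubic_seq_relation_type_1:
  assumes "cubic_type p q 1 r" and "\<not> int p dvd r\<^sup>2 + 3"
    and "int p dvd 4 * Y - 9 * (r\<^sup>2 + 3)"
  defines "u \<equiv> cubic_seq Y"
  shows "int p dvd (1 + 3 * r\<^sup>2) * u (p + i + 1) - 2 * (1 + r) * u (p + i)
    - 2 * (1 - r) * u (i + 1) + 4 * u i" (is "_ dvd ?N")
proof -
  have "(omega ^ 2 - 1) * (omega ^ 1 * (4 * of_int (u i)
      - 2 * (1 - eis_sqrt_m3 * of_int r) * of_int (u (i + 1))
      - 2 * (1 + eis_sqrt_m3 * of_int r) * of_int (u (p + i))
      + (1 + eis_sqrt_m3 * of_int r) * (1 - eis_sqrt_m3 * of_int r) * of_int (u (p + i + 1)))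
    - (4 * of_int (u i)
      - 2 * (1 + eis_sqrt_m3 * of_int r) * of_int (u (i + 1))
      - 2 * (1 - eis_sqrt_m3 * of_int r) * of_int (u (p + i))
      + (1 + eis_sqrt_m3 * of_int r) * (1 - eis_sqrt_m3 * of_int r) * of_int (u (p + i + 1))))
    = 3 * of_int ?N"
    by (simp add: eis_sqrt_m3_def eis_simps power2_eq_square algebra_simps)
  then have "q dvd 3 * of_int ?N"
    using dvd_mult[OF cubic_seq_relation[OF assms(1-3), of i], of "omega ^ 2 - 1"] by (simp add: u_def)
  then show ?thesis by (rule dvd_cancel_3)
qed

text \<open>Here \<omega>^2 A = B, and \<omega> - 1 produces the sum of conjugates (1 - \<omega>^2)
  A + (1 - \<omega>) B.\<close>

lemma cubic_seq_relation_type_2: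
  assumes "cubic_type p q 2 r" and "\<not> int p dvd r\<^sup>2 + 3"
    and "int p dvd 4 * Y - 9 * (r\<^sup>2 + 3)"
  defines "u \<equiv> cubic_seq Y"
  shows "int p dvd (1 + 3 * r\<^sup>2) * u (p + i + 1) - 2 * (1 - r) * u (p + i)
    - 2 * (1 + r) * u (i + 1) + 4 * u i" (is "_ dvd ?N")
proof -
  have "(omega - 1) * (omega ^ 2 * (4 * of_int (u i)
      - 2 * (1 - eis_sqrt_m3 * of_int r) * of_int (u (i + 1))
      - 2 * (1 + eis_sqrt_m3 * of_int r) * of_int (u (p + i))
      + (1 + eis_sqrt_m3 * of_int r) * (1 - eis_sqrt_m3 * of_int r) * of_int (u (p + i + 1)))
    - (4 * of_int (u i)
      - 2 * (1 + eis_sqrt_m3 * of_int r) * of_int (u (i + 1))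
      - 2 * (1 - eis_sqrt_m3 * of_int r) * of_int (u (p + i))
      + (1 + eis_sqrt_m3 * of_int r) * (1 - eis_sqrt_m3 * of_int r) * of_int (u (p + i + 1))))
    = 3 * of_int ?N"
    by (simp add: eis_sqrt_m3_def eis_simps power2_eq_square algebra_simps)
  then have "q dvd 3 * of_int ?N"
    using dvd_mult[OF cubic_seq_relation[OF assms(1-3), of i], of "omega - 1"] by (simp add: u_def)
  then show ?thesis by (rule dvd_cancel_3)
qed

text \<open>
  Three consecutive instances of the relation form a linear system for \<open>u p\<close>, \<open>u (p + 1)\<close>,
  \<open>u (p + 2)\<close> of determinant \<open>64 r\<^sup>3\<close>; the multipliers below are its cofactors.
\<close>

lemma cubic_seq_solve:
  fixes r Y :: int
  defines "u \<equiv> cubic_seq Y"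
  assumes r: "\<not> int p dvd r" and Y: "int p dvd 4 * Y - 9 * (r\<^sup>2 + 3)"
    and rel: "\<And>i. int p dvd (1 + 3 * r\<^sup>2) * u (p + i + 1) - 2 * (1 + r) * u (p + i)
    - 2 * (1 - r) * u (i + 1) + 4 * u i"
  shows "int p dvd 2 * r * u (p + 1) + (1 + r)" and "int p dvd 4 * r * u p + (1 + 3 * r\<^sup>2)"
proof -
  define D where "D = 1 + 3 * r\<^sup>2"
  define b where "b = 2 * (1 + r)"
  have u: "u 0 = 0" "u 1 = 0" "u 2 = 1" "u 3 = Y - 3"
    by (simp_all add: u_def numeral_2_eq_2 numeral_3_eq_3)
  have up: "u (p + 3) = (Y - 3) * u (p + 2) - 3 * u (p + 1) - u p"
    by (simp add: u_def numeral_2_eq_2 numeral_3_eq_3)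
  have e0: "int p dvd D * u (p + 1) - b * u p"
    using rel[of 0] u by (simp add: D_def b_def)
  have e1: "int p dvd D * u (p + 2) - b * u (p + 1) - 2 * (1 - r)"
    using rel[of 1] u by (simp add: D_def b_def numeral_2_eq_2)
  have e2: "int p dvd D * ((Y - 3) * u (p + 2) - 3 * u (p + 1) - u p) - b * u (p + 2)
      - 2 * (1 - r) * (Y - 3) + 4"
    using rel[of 2] u up by (simp add: D_def b_def numeral_2_eq_2 numeral_3_eq_3)
  let ?e0 = "D * u (p + 1) - b * u p"
  let ?e1 = "D * u (p + 2) - b * u (p + 1) - 2 * (1 - r)"
  let ?e2 = "D * ((Y - 3) * u (p + 2) - 3 * u (p + 1) - u p) - b * u (p + 2)
      - 2 * (1 - r) * (Y - 3) + 4"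
  have dvd: "int p dvd 4 * (c0 * ?e0 + c1 * ?e1 + c2 * ?e2) - (4 * Y - 9 * (r\<^sup>2 + 3)) * c3"
    for c0 c1 c2 c3
    by (rule dvd_diff[OF dvd_mult[OF dvd_add[OF dvd_add[OF dvd_mult[OF e0] dvd_mult[OF e1]]
            dvd_mult[OF e2]]] dvd_mult2[OF Y]])
  have det: "b\<^sup>2 * (D * (9 * (r\<^sup>2 + 3) - 12) - 4 * b) - 12 * b * D\<^sup>2 - 4 * D ^ 3 = 256 * r ^ 3"
    by (simp add: D_def b_def algebra_simps power2_eq_square power3_eq_cube)
  have bD: "(1 - r) * b - 2 * D = - 8 * r\<^sup>2"
    by (simp add: D_def b_def algebra_simps power2_eq_square)
  \<comment> \<open>By \<open>det\<close> and \<open>bD\<close> a factor 2^7 r^2 splits off; it is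
    2^6 r^2 for the other unknown.\<close>
  from dvd[of "- (D * D)" "- b * (D * (Y - 3) - b)" "b * D" "b\<^sup>2 * D * u (p + 1)"]
  have "int p dvd 2 ^ 7 * (r * (r * (2 * r * u (p + 1) + (1 + r))))"
    unfolding cubic_system_cofactors_1 det bD by (simp add: b_def algebra_simps power2_eq_square power3_eq_cube)
  then show "int p dvd 2 * r * u (p + 1) + (1 + r)"
    using prime_dvd_mult_cancel_int not_dvd_2_power r by blast
  from dvd[of "3 * D\<^sup>2 - b * (D * (Y - 3) - b)" "- D * (D * (Y - 3) - b)" "D\<^sup>2" "b\<^sup>2 * D * u p"]
  have "int p dvd 2 ^ 6 * (r * (r * (4 * r * u p + (1 + 3 * r\<^sup>2))))"
    unfolding cubic_system_cofactors_0 det bD by (simp add: D_def algebra_simps power2_eq_square power3_eq_cube)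
  then show "int p dvd 4 * r * u p + (1 + 3 * r\<^sup>2)"
    using prime_dvd_mult_cancel_int not_dvd_2_power r by blast
qed

lemma cubic_seq_type_1:
  assumes "cubic_type p q 1 r" and "\<not> int p dvd r\<^sup>2 + 3" and "\<not> int p dvd r"
    and "int p dvd 4 * Y - 9 * (r\<^sup>2 + 3)"
  shows "int p dvd 2 * r * cubic_seq Y (p + 1) + (1 + r)"
    and "int p dvd 4 * r * cubic_seq Y p + (1 + 3 * r\<^sup>2)"
  using cubic_seq_solve[OF assms(3,4) cubic_seq_relation_type_1[OF assms(1,2,4)]] by auto

text \<open>The relation for type 2 is that for type 1 with r replaced by - r, and Y depends on r^2
  only.\<close>

lemma cubic_seq_type_2:
  assumes "cubic_type p q 2 r" and "\<not> int p dvd r\<^sup>2 + 3" and "\<not> int p dvd r"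
    and "int p dvd 4 * Y - 9 * (r\<^sup>2 + 3)"
  shows "int p dvd 2 * r * cubic_seq Y (p + 1) - (1 - r)"
    and "int p dvd 4 * r * cubic_seq Y p - (1 + 3 * r\<^sup>2)"
proof -
  have 1: "\<not> int p dvd - r" "int p dvd 4 * Y - 9 * ((- r)\<^sup>2 + 3)"
    using assms(3,4) by simp_all
  have 2: "int p dvd (1 + 3 * (- r)\<^sup>2) * cubic_seq Y (p + i + 1) - 2 * (1 + - r) * cubic_seq Y (p + i)
    - 2 * (1 - - r) * cubic_seq Y (i + 1) + 4 * cubic_seq Y i" for i
    using cubic_seq_relation_type_2[OF assms(1,2,4), of i] by simp
  have "int p dvd - (2 * r * cubic_seq Y (p + 1) - (1 - r))"
    "int p dvd - (4 * r * cubic_seq Y p - (1 + 3 * r\<^sup>2))"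
    using cubic_seq_solve[OF 1 2] by (simp_all add: algebra_simps)
  then show "int p dvd 2 * r * cubic_seq Y (p + 1) - (1 - r)"
    and "int p dvd 4 * r * cubic_seq Y p - (1 + 3 * r\<^sup>2)"
    by (simp_all only: dvd_minus_iff)
qed

end

section \<open>Congruences of \<open>p\<close>-integral rationals\<close>

text \<open>Allows fractions that are not in lowest terms: the reduced denominator divides every
  other one.\<close>

lemma D_set_iff: "x \<in> D_set p \<longleftrightarrow> (\<exists>a b. \<not> int p dvd b \<and> x = of_int a / of_int b)"
proof
  assume "x \<in> D_set p"
  moreover obtain a b where ab: "quotient_of x = (a, b)" by fastforce
  ultimately show "\<exists>a b. \<not> int p dvd b \<and> x = of_int a / of_int b"
    using quotient_of_div[OF ab] by (auto simp: D_set_def)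
next
  assume "\<exists>a b. \<not> int p dvd b \<and> x = of_int a / of_int b"
  then obtain a b where ab: "\<not> int p dvd b" "x = of_int a / of_int b" by blast
  obtain n d where nd: "quotient_of x = (n, d)" by fastforce
  have "d > 0" "coprime n d" "x = of_int n / of_int d"
    using nd by (auto intro: quotient_of_denom_pos quotient_of_coprime quotient_of_div)
  moreover have "b \<noteq> 0" using ab(1) by auto
  ultimately have "of_int (n * b) = (of_int (a * d) :: rat)"
    using ab(2) by (simp add: field_simps)
  then have "n * b = a * d" by (simp only: of_int_eq_iff)
  then have "d dvd n * b" by simp
  then have "d dvd b"
    using \<open>coprime n d\<close> by (simp add: coprime_dvd_mult_right_iff coprime_commute)
  then show "x \<in> D_set p"
    using ab(1) nd dvd_trans by (auto simp: D_set_def)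
qed

locale prime_reduction =
  fixes p :: nat
  assumes prime_p: "prime p"
begin

lemma prime_int_p: "prime (int p)"
  using prime_p by simp

lemma D_set_of_int [intro, simp]: "of_int n \<in> D_set p"
proof -
  have "\<not> int p dvd 1" using prime_p not_prime_1 by auto
  then show ?thesis unfolding D_set_iff by (intro exI[of _ n] exI[of _ 1]) auto
qed

lemma D_set_numeral [intro, simp]: "numeral n \<in> D_set p"
  using D_set_of_int[of "numeral n"] by simp

lemma D_set_0 [intro, simp]: "0 \<in> D_set p" and D_set_1 [intro, simp]: "1 \<in> D_set p"
  using D_set_of_int[of 0] D_set_of_int[of 1] by simp_all

lemma D_set_add [intro]:
  assumes "x \<in> D_set p" "y \<in> D_set p"
  shows "x + y \<in> D_set p"
proof -
  obtain a b c d where *: "\<not> int p dvd b" "x = of_int a / of_int b"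
    "\<not> int p dvd d" "y = of_int c / of_int d"
    using assms unfolding D_set_iff by blast
  then have "b \<noteq> 0" "d \<noteq> 0" by auto
  with * have "\<not> int p dvd b * d" "x + y = of_int (a * d + c * b) / of_int (b * d)"
    using prime_int_p by (auto simp: prime_dvd_mult_iff field_simps)
  then show ?thesis unfolding D_set_iff by blast
qed

lemma D_set_mult [intro]:
  assumes "x \<in> D_set p" "y \<in> D_set p"
  shows "x * y \<in> D_set p"
proof -
  obtain a b c d where *: "\<not> int p dvd b" "x = of_int a / of_int b"
    "\<not> int p dvd d" "y = of_int c / of_int d"
    using assms unfolding D_set_iff by blast
  then have "\<not> int p dvd b * d" "x * y = of_int (a * c) / of_int (b * d)"
    using prime_int_p by (auto simp: prime_dvd_mult_iff)
  then show ?thesis unfolding D_set_iff by blast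
qed

lemma D_set_minus [intro]: "x \<in> D_set p \<Longrightarrow> - x \<in> D_set p"
  using D_set_mult[OF D_set_of_int[of "- 1"], of x] by simp

lemma D_set_power [intro]: "x \<in> D_set p \<Longrightarrow> x ^ n \<in> D_set p"
  by (induction n) auto

lemma D_set_divide:
  assumes "x \<in> D_set p" "u \<in> D_set p" "\<not> rat_cong p u 0"
  shows "x / u \<in> D_set p"
proof -
  obtain a b where ab: "\<not> int p dvd b" "u = of_int a / of_int b"
    using assms(2) unfolding D_set_iff by blast
  have "\<not> int p dvd a"
  proof
    assume "int p dvd a"
    then obtain k where "a = int p * k" ..
    then have "u - 0 = of_nat p * (of_int k / of_int b)" using ab by simp
    moreover have "of_int k / of_int b \<in> D_set p"
      using ab unfolding D_set_iff by blast
    ultimately show False using assms(3) unfolding rat_cong_def by blast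
  qed
  then have "of_int b / of_int a \<in> D_set p"
    unfolding D_set_iff by blast
  then have "x * (of_int b / of_int a) \<in> D_set p"
    using assms(1) by blast
  then show ?thesis using ab(2) by simp
qed

lemma rat_cong_refl [simp, intro]: "rat_cong p x x"
  unfolding rat_cong_def by (intro bexI[of _ 0]) auto

lemma rat_cong_sym: "rat_cong p x y \<Longrightarrow> rat_cong p y x"
proof -
  assume "rat_cong p x y"
  then obtain z where "z \<in> D_set p" "x - y = of_nat p * z"
    unfolding rat_cong_def by blast
  then have "- z \<in> D_set p" "y - x = of_nat p * (- z)" by auto
  then show ?thesis unfolding rat_cong_def by blast
qed

lemma rat_cong_add:
  assumes "rat_cong p x y" "rat_cong p x' y'"
  shows "rat_cong p (x + x') (y + y')"
proof -
  obtain z z' where "z \<in> D_set p" "x - y = of_nat p * z" "z' \<in> D_set p" "x' - y' = of_nat p * z'"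
    using assms unfolding rat_cong_def by blast
  then have "z + z' \<in> D_set p" "x + x' - (y + y') = of_nat p * (z + z')"
    by (auto simp: algebra_simps)
  then show ?thesis unfolding rat_cong_def by blast
qed

lemma rat_cong_trans [trans]:
  assumes "rat_cong p x y" "rat_cong p y z"
  shows "rat_cong p x z"
  using rat_cong_add[OF assms] by (simp add: rat_cong_def)

lemma rat_cong_mult_left:
  assumes "rat_cong p x y" "u \<in> D_set p"
  shows "rat_cong p (u * x) (u * y)"
proof -
  obtain z where "z \<in> D_set p" "x - y = of_nat p * z"
    using assms unfolding rat_cong_def by blast
  then have "u * z \<in> D_set p" "u * x - u * y = of_nat p * (u * z)"
    using assms(2) by (auto simp: algebra_simps)
  then show ?thesis unfolding rat_cong_def by blast
qed

lemma rat_cong_mult: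
  assumes "rat_cong p x y" "rat_cong p x' y'" "x \<in> D_set p" "y' \<in> D_set p"
  shows "rat_cong p (x * x') (y * y')"
proof -
  have "rat_cong p (x * x') (x * y')"
    using assms by (intro rat_cong_mult_left)
  also have "rat_cong p (x * y') (y * y')"
    using rat_cong_mult_left[OF assms(1,4)] by (simp add: mult.commute)
  finally show ?thesis .
qed

lemma rat_cong_minus: "rat_cong p x y \<Longrightarrow> rat_cong p (- x) (- y)"
  using rat_cong_mult_left[OF _ D_set_of_int[of "- 1"], of x y] by simp

lemma rat_cong_power:
  assumes "rat_cong p x y" "x \<in> D_set p" "y \<in> D_set p"
  shows "rat_cong p (x ^ n) (y ^ n)"
  by (induction n) (auto intro!: rat_cong_mult assms)

lemma rat_cong_sum:
  "(\<And>k. k \<in> A \<Longrightarrow> rat_cong p (f k) (g k)) \<Longrightarrow> rat_cong p (sum f A) (sum g A)"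
  by (induction A rule: infinite_finite_induct) (auto intro: rat_cong_add)

lemma rat_cong_of_int_iff: "rat_cong p (of_int a) (of_int b) \<longleftrightarrow> int p dvd a - b"
proof
  assume "rat_cong p (of_int a) (of_int b)"
  then obtain z where z: "z \<in> D_set p" "of_int a - of_int b = of_nat p * z"
    unfolding rat_cong_def by blast
  then obtain c d where cd: "\<not> int p dvd d" "z = of_int c / of_int d"
    unfolding D_set_iff by blast
  then have "d \<noteq> 0" by auto
  then have "of_int ((a - b) * d) = (of_int (int p * c) :: rat)"
    using z cd by (simp add: field_simps)
  then have "(a - b) * d = int p * c" by (simp only: of_int_eq_iff)
  then have "int p dvd (a - b) * d" by simp
  then show "int p dvd a - b"
    using cd(1) prime_int_p by (simp add: prime_dvd_mult_iff)
next
  assume "int p dvd a - b"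
  then obtain k where "a - b = int p * k" ..
  then have "of_int a - of_int b = of_nat p * (of_int k :: rat)"
    by (simp flip: of_int_diff)
  then show "rat_cong p (of_int a) (of_int b)"
    unfolding rat_cong_def by blast
qed

lemma rat_cong_cancel:
  assumes "rat_cong p (u * x) (u * y)" "u \<in> D_set p" "\<not> rat_cong p u 0"
  shows "rat_cong p x y"
proof -
  obtain z where z: "z \<in> D_set p" "u * x - u * y = of_nat p * z"
    using assms unfolding rat_cong_def by blast
  have "u \<noteq> 0" using assms(3) by auto
  then have "x - y = of_nat p * (z / u)"
    using z(2) by (simp add: field_simps)
  then show ?thesis
    using D_set_divide[OF z(1) assms(2,3)] unfolding rat_cong_def by blast
qed

lemma ex_inverse_mod:
  assumes "\<not> int p dvd a"
  shows "\<exists>b. int p dvd a * b - 1"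
proof -
  have "coprime a (int p)"
    using assms prime_int_p by (metis coprime_commute prime_imp_coprime)
  then obtain b where "[a * b = 1] (mod int p)"
    using cong_solve_coprime_int by blast
  then show ?thesis by (auto simp: cong_iff_dvd_diff)
qed

text \<open>The \<open>THE\<close> in \<open>rat_reduce\<close> is well defined: the denominator is
  invertible modulo p, and residues in the range are unique.\<close>

lemma rat_reduce_bounds_and_cong:
  assumes "c \<in> D_set p"
  shows "0 \<le> rat_reduce p c \<and> rat_reduce p c < int p \<and> rat_cong p c (of_int (rat_reduce p c))"
  unfolding rat_reduce_def
proof (rule theI')
  show "\<exists>!r. 0 \<le> r \<and> r < int p \<and> rat_cong p c (of_int r)"
  proof (rule ex_ex1I)
    obtain a b where ab: "\<not> int p dvd b" "c = of_int a / of_int b"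
      using assms unfolding D_set_iff by blast
    then have "b \<noteq> 0" by auto
    obtain b' where b': "int p dvd b * b' - 1"
      using ex_inverse_mod[OF ab(1)] by blast
    define r where "r = (a * b') mod int p"
    have ab': "int p dvd a * b' - r"
      by (simp add: r_def minus_mod_eq_mult_div)
    have "int p dvd b * (a * b' - r) - a * (b * b' - 1)"
      by (rule dvd_diff[OF dvd_mult[OF ab'] dvd_mult[OF b']])
    then have "int p dvd a - b * r" by (simp add: algebra_simps)
    then have "rat_cong p (of_int a) (of_int (b * r))"
      by (simp only: rat_cong_of_int_iff)
    then have "rat_cong p (of_int b * c) (of_int b * of_int r)"
      using ab(2) \<open>b \<noteq> 0\<close> by simp
    moreover have "\<not> rat_cong p (of_int b) 0"
      using rat_cong_of_int_iff[of b 0] ab(1) by simp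
    ultimately have "rat_cong p c (of_int r)"
      using rat_cong_cancel by blast
    moreover have "0 \<le> r" "r < int p"
      using prime_gt_0_nat[OF prime_p] by (simp_all add: r_def)
    ultimately show "\<exists>r. 0 \<le> r \<and> r < int p \<and> rat_cong p c (of_int r)" by blast
  next
    fix r s assume rs: "0 \<le> r \<and> r < int p \<and> rat_cong p c (of_int r)"
      "0 \<le> s \<and> s < int p \<and> rat_cong p c (of_int s)"
    then have "rat_cong p (of_int r) (of_int s)"
      using rat_cong_sym rat_cong_trans by blast
    then have "int p dvd r - s"
      by (simp only: rat_cong_of_int_iff)
    then have "r mod int p = s mod int p"
      by (simp add: mod_eq_dvd_iff)
    then show "r = s" using rs by simp
  qed
qed

text \<open>Integers that represent 4 / m and m / 4 modulo p, that is, the argument of a sum and its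
  inverse.\<close>

lemma ex_reciprocal_pair:
  assumes "\<not> int p dvd m" "\<not> int p dvd 4"
  shows "\<exists>X Y. int p dvd X * Y - 1 \<and> int p dvd 4 * Y - m \<and> int p dvd m * X - 4"
proof -
  obtain k where k: "int p dvd m * k - 1"
    using ex_inverse_mod[OF assms(1)] by blast
  obtain l where l: "int p dvd 4 * l - 1"
    using ex_inverse_mod[OF assms(2)] by blast
  have "4 * k * (l * m) - 1 = (4 * l - 1) * (m * k) + (m * k - 1)"
    "4 * (l * m) - m = (4 * l - 1) * m" "m * (4 * k) - 4 = 4 * (m * k - 1)"
    by (simp_all add: algebra_simps)
  then have "int p dvd 4 * k * (l * m) - 1" "int p dvd 4 * (l * m) - m" "int p dvd m * (4 * k) - 4"
    using dvd_add[OF dvd_mult2[OF l, of "m * k"] k] dvd_mult2[OF l, of m] dvd_mult[OF k, of 4]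
    by (simp_all only:)
  then show ?thesis by blast
qed

section \<open>The two sums as values of the recurrence\<close>

lemma power_sum_cong:
  assumes "x \<in> D_set p" "rat_cong p x (of_int X)"
  shows "rat_cong p (\<Sum>k=0..p-1. of_int (w k) * x ^ k) (of_int (\<Sum>k<p. w k * X ^ k))"
proof -
  have "rat_cong p (\<Sum>k<p. of_int (w k) * x ^ k) (\<Sum>k<p. of_int (w k) * of_int X ^ k)"
    using assms by (intro rat_cong_sum rat_cong_mult rat_cong_power) auto
  moreover have "{0..p-1} = {..<p}"
    using prime_gt_0_nat[OF prime_p] by auto
  ultimately show ?thesis by simp
qed

lemma binomial_sum_cong_cubic_seq:
  assumes "x \<in> D_set p" "rat_cong p x (of_int X)" "int p dvd X * Y - 1"
  shows "rat_cong p (\<Sum>k=0..p-1. of_nat (3 * k choose k) * x ^ k) (of_int (cubic_seq Y (p + 1)))"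
proof -
  have "rat_cong p (\<Sum>k=0..p-1. of_int (int (3 * k choose k)) * x ^ k)
      (of_int (\<Sum>k<p. int (3 * k choose k) * X ^ k))"
    using assms(1,2) by (rule power_sum_cong)
  also have "rat_cong p (of_int (\<Sum>k<p. int (3 * k choose k) * X ^ k)) (of_int (cubic_seq Y (p + 1)))"
    using binomial_sum_cong[OF prime_p assms(3), of 0] prime_gt_0_nat[OF prime_p]
    by (simp only: rat_cong_of_int_iff) simp
  finally show ?thesis by simp
qed

text \<open>Follows from k (3k choose k) = (2k + 1) (3k choose (k - 1)). An integral form is
  essential since 2 k + 1 equals p at k = (p - 1) / 2.\<close>

lemma catalan2_eq:
  "catalan2 k = of_int (int (3 * k choose k) - 2 * (if k < 1 then 0 else int (3 * k choose (k - 1))))"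
proof (cases k)
  case 0
  then show ?thesis by (simp add: catalan2_def)
next
  case (Suc m)
  have aux: "1 / d * n = y" if "n = d * y" "d \<noteq> 0" for n d y :: rat
    using that by simp
  have "Suc m * (3 * k choose Suc m) = (3 * k - m) * (3 * k choose m)"
    by (simp only: binomial_absorption binomial_absorb_comp)
  then have "k * (3 * k choose k) = (2 * k + 1) * (3 * k choose (k - 1))"
    using Suc by (simp add: algebra_simps)
  then have "of_nat (k * (3 * k choose k)) = (of_nat ((2 * k + 1) * (3 * k choose (k - 1))) :: rat)"
    by (rule arg_cong)
  then have "of_nat (3 * k choose k) = (of_nat (2 * k + 1) :: rat) *
      (of_nat (3 * k choose k) - 2 * of_nat (3 * k choose (k - 1)))"
    by (simp add: algebra_simps)
  moreover have "(of_nat (2 * k + 1) :: rat) \<noteq> 0"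
    by (simp only: of_nat_eq_0_iff)
  ultimately have "1 / of_nat (2 * k + 1) * of_nat (3 * k choose k) =
      (of_nat (3 * k choose k) - 2 * of_nat (3 * k choose (k - 1)) :: rat)"
    using aux by blast
  then show ?thesis using Suc by (simp add: catalan2_def)
qed

text \<open>Kept apart from the evaluation by \<open>cubic_seq\<close> because for c = 0 modulo p
  the argument is 0 and has no inverse \<open>Y\<close>.\<close>

lemma catalan2_sum_cong:
  assumes "x \<in> D_set p" "rat_cong p x (of_int X)"
  shows "rat_cong p (\<Sum>k=0..p-1. catalan2 k * x ^ k)
    (of_int ((\<Sum>k<p. int (3 * k choose k) * X ^ k)
      - 2 * (\<Sum>k<p. (if k < 1 then 0 else int (3 * k choose (k - 1))) * X ^ k)))"
proof -
  have "(\<Sum>k<p. int (3 * k choose k) * X ^ k)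
      - 2 * (\<Sum>k<p. (if k < 1 then 0 else int (3 * k choose (k - 1))) * X ^ k) =
    (\<Sum>k<p. (int (3 * k choose k) - 2 * (if k < 1 then 0 else int (3 * k choose (k - 1)))) * X ^ k)"
    by (simp add: sum_subtractf sum_distrib_left left_diff_distrib mult.assoc)
  then show ?thesis
    unfolding catalan2_eq using power_sum_cong[OF assms] by presburger
qed

lemma catalan2_sum_cong_cubic_seq:
  assumes "x \<in> D_set p" "rat_cong p x (of_int X)" "int p dvd X * Y - 1"
  shows "rat_cong p (\<Sum>k=0..p-1. catalan2 k * x ^ k)
    (of_int (cubic_seq Y (p + 1) - 2 * cubic_seq Y p))"
proof -
  have 1: "int p dvd (\<Sum>k<p. int (3 * k choose k) * X ^ k) - cubic_seq Y (p + 1)"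
    using binomial_sum_cong[OF prime_p assms(3), of 0] prime_gt_0_nat[OF prime_p] by simp
  have 2: "int p dvd (\<Sum>k<p. (if k < 1 then 0 else int (3 * k choose (k - 1))) * X ^ k)
      - cubic_seq Y p"
    using binomial_sum_cong[OF prime_p assms(3), of 1] prime_gt_1_nat[OF prime_p] by simp
  have "int p dvd ((\<Sum>k<p. int (3 * k choose k) * X ^ k) - cubic_seq Y (p + 1))
     - 2 * ((\<Sum>k<p. (if k < 1 then 0 else int (3 * k choose (k - 1))) * X ^ k) - cubic_seq Y p)"
    by (rule dvd_diff[OF 1 dvd_mult[OF 2]])
  then have "int p dvd ((\<Sum>k<p. int (3 * k choose k) * X ^ k)
      - 2 * (\<Sum>k<p. (if k < 1 then 0 else int (3 * k choose (k - 1))) * X ^ k))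
     - (cubic_seq Y (p + 1) - 2 * cubic_seq Y p)"
    by (simp only: algebra_simps)
  then show ?thesis
    using rat_cong_trans[OF catalan2_sum_cong[OF assms(1,2)]] by (simp only: rat_cong_of_int_iff)
qed

end

section \<open>The two congruences\<close>

lemma cubic_type_4: "cubic_type p q 4 r \<longleftrightarrow> cubic_type p q 1 r"
  using omega_power_add_3[of 1] by (simp add: cubic_type_def)

lemma omega_neq_1: "omega ^ 1 \<noteq> 1" "omega ^ 2 \<noteq> 1"
  by (simp_all add: eis_simps power2_eq_square)

text \<open>The first congruence is guarded by c being nonzero modulo p: for p = 5 and c = 0, which
  lies in class 0, the first sum is 4 modulo 5.\<close>

theorem theorem26:
  fixes p :: nat and c :: rat
  assumes "prime p" and "p > 3"
    and "c \<in> D_set p" and "\<not> rat_cong p (c^2) (- 3)"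
  shows "(\<not> rat_cong p c 0 \<longrightarrow>
          (let S = (\<Sum>k=0..p-1. of_nat ((3 * k) choose k) * (4 / (9 * (c^2 + 3))) ^ k)
           in (c \<in> C_set 0 p \<longrightarrow> rat_cong p S 1) \<and>
              (c \<in> C_set 1 p \<longrightarrow> rat_cong p S (- ((1 + c) / (2 * c)))) \<and>
              (c \<in> C_set 2 p \<longrightarrow> rat_cong p S ((1 - c) / (2 * c))))) \<and>
         (let T = (\<Sum>k=0..p-1. catalan2 k * (4 * c^2 / (27 * (c^2 + 3))) ^ k)
          in (c \<in> C_set 0 p \<longrightarrow> rat_cong p T 1) \<and>
             (c \<in> C_set 1 p \<longrightarrow> rat_cong p T (- ((9 + c) / (2 * c)))) \<and>
             (c \<in> C_set 2 p \<longrightarrow> rat_cong p T ((9 - c) / (2 * c))))"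
proof -
  interpret prime_reduction p
    by standard (rule assms)
  define r where "r = rat_reduce p c"
  have r: "0 \<le> r" "r < int p" "rat_cong p c (of_int r)"
    using rat_reduce_bounds_and_cong[OF assms(3)] by (auto simp: r_def)
  note c = assms(3)
  have type: "\<exists>q. eis_prime_above p q \<and> cubic_type p q j r" if "c \<in> C_set j p" for j
    using ex_cubic_type[OF assms(1,2)] that by (simp add: C_set_def r_def)
  have cancel: "int p dvd b" if "int p dvd a * b" "\<not> int p dvd a" for a b :: int
    using that prime_int_p by (simp add: prime_dvd_mult_iff)
  have small: "\<not> int p dvd 2" "\<not> int p dvd 3"
    using assms(2) by (auto dest: zdvd_imp_le)
  have numerals: "\<not> int p dvd 4" "\<not> int p dvd 9" "\<not> int p dvd 27"
    using cancel[of 2 2] cancel[of 3 3] cancel[of 3 9] small by auto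
  have c2: "rat_cong p (c\<^sup>2 + 3) (of_int (r\<^sup>2 + 3))"
    using rat_cong_add[OF rat_cong_power[OF r(3) c, of 2] rat_cong_refl[of 3]] by simp
  have r3: "\<not> int p dvd r\<^sup>2 + 3"
  proof
    assume "int p dvd r\<^sup>2 + 3"
    then have "rat_cong p (of_int (r\<^sup>2 + 3)) (of_int 0)"
      by (simp only: rat_cong_of_int_iff diff_0_right)
    from rat_cong_add[OF rat_cong_trans[OF c2 this] rat_cong_refl[of "- 3"]]
    show False using assms(4) by simp
  qed
  have c_cong_0: "rat_cong p c 0 \<longleftrightarrow> int p dvd r"
  proof -
    have "rat_cong p c 0 \<longleftrightarrow> rat_cong p (of_int r) (of_int 0)"
      using r(3) rat_cong_sym rat_cong_trans by (metis of_int_0)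
    then show ?thesis by (simp only: rat_cong_of_int_iff diff_0_right)
  qed
  have unit: "\<not> rat_cong p (a * (c\<^sup>2 + 3)) 0" "rat_cong p (a * (c\<^sup>2 + 3)) (of_int (k * (r\<^sup>2 + 3)))"
    "a * (c\<^sup>2 + 3) \<in> D_set p"
    if "a = of_int k" "\<not> int p dvd k" for a k
  proof -
    show cong: "rat_cong p (a * (c\<^sup>2 + 3)) (of_int (k * (r\<^sup>2 + 3)))"
      using rat_cong_mult_left[OF c2, of a] that(1) by simp
    show "a * (c\<^sup>2 + 3) \<in> D_set p"
      using c that(1) by auto
    show "\<not> rat_cong p (a * (c\<^sup>2 + 3)) 0"
    proof
      assume "rat_cong p (a * (c\<^sup>2 + 3)) 0"
      then have "rat_cong p (of_int (k * (r\<^sup>2 + 3))) (of_int 0)"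
        using rat_cong_trans[OF rat_cong_sym[OF cong]] by simp
      then have "int p dvd k * (r\<^sup>2 + 3)"
        by (simp only: rat_cong_of_int_iff diff_0_right)
      then show False using cancel that(2) r3 by blast
    qed
  qed
  \<comment> \<open>Reduces a congruence with denominator 2 c to an integer divisibility in terms of
    the residue \<open>r\<close>.\<close>
  have clear: "rat_cong p S (y / (2 * c))"
    if "rat_cong p S (of_int a)" "rat_cong p y (of_int b)" "int p dvd 2 * r * a - b"
      "\<not> int p dvd r" for S y a b
  proof (rule rat_cong_cancel)
    have c0: "c \<noteq> 0" using c_cong_0 that(4) by auto
    have 2: "rat_cong p (2 * c) (of_int (2 * r))"
      using rat_cong_mult_left[OF r(3), of 2] by simp
    show D: "2 * c \<in> D_set p" using c by auto
    have "rat_cong p (2 * c * S) (2 * c * of_int a)"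
      by (rule rat_cong_mult_left[OF that(1) D])
    also have "rat_cong p (2 * c * of_int a) (of_int (2 * r) * of_int a)"
      by (rule rat_cong_mult[OF 2 rat_cong_refl D]) simp
    also have "rat_cong p (of_int (2 * r) * of_int a) (of_int b)"
      using that(3) rat_cong_of_int_iff[of "2 * r * a" b] by simp
    also have "rat_cong p (of_int b) (2 * c * (y / (2 * c)))"
      using rat_cong_sym[OF that(2)] c0 by simp
    finally show "rat_cong p (2 * c * S) (2 * c * (y / (2 * c)))" .
    show "\<not> rat_cong p (2 * c) 0"
    proof
      assume "rat_cong p (2 * c) 0"
      from rat_cong_trans[OF rat_cong_sym[OF 2] this]
      have "int p dvd 2 * r"
        using rat_cong_of_int_iff[of "2 * r" 0] by simp
      then show False using cancel small(1) that(4) by blast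
    qed
  qed
  have part1: "(let S = (\<Sum>k=0..p-1. of_nat ((3 * k) choose k) * (4 / (9 * (c^2 + 3))) ^ k)
           in (c \<in> C_set 0 p \<longrightarrow> rat_cong p S 1) \<and>
              (c \<in> C_set 1 p \<longrightarrow> rat_cong p S (- ((1 + c) / (2 * c)))) \<and>
              (c \<in> C_set 2 p \<longrightarrow> rat_cong p S ((1 - c) / (2 * c))))"
    if "\<not> rat_cong p c 0"
  proof -
    have pr: "\<not> int p dvd r" using that c_cong_0 by simp
    define x where "x = 4 / (9 * (c\<^sup>2 + 3))"
    note u = unit[of 9 9, OF _ numerals(2)]
    have u0: "9 * (c\<^sup>2 + 3) \<noteq> 0" using u(1) by auto
    obtain X Y where XY: "int p dvd X * Y - 1" and Y: "int p dvd 4 * Y - 9 * (r\<^sup>2 + 3)"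
      and X: "int p dvd 9 * (r\<^sup>2 + 3) * X - 4"
      using ex_reciprocal_pair[of "9 * (r\<^sup>2 + 3)"] cancel numerals r3 by metis
    have xD: "x \<in> D_set p"
      unfolding x_def using u by (intro D_set_divide) auto
    have xX: "rat_cong p x (of_int X)"
    proof (rule rat_cong_cancel)
      have "int p dvd 4 - 9 * (r\<^sup>2 + 3) * X"
        using X by (rule dvd_diff_sym)
      then have "rat_cong p 4 (of_int (9 * (r\<^sup>2 + 3)) * of_int X)"
        using rat_cong_of_int_iff[of 4 "9 * (r\<^sup>2 + 3) * X"] by simp
      also have "rat_cong p (of_int (9 * (r\<^sup>2 + 3)) * of_int X) (9 * (c\<^sup>2 + 3) * of_int X)"
        using u by (intro rat_cong_mult rat_cong_sym[OF u(2)]) auto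
      finally show "rat_cong p (9 * (c\<^sup>2 + 3) * x) (9 * (c\<^sup>2 + 3) * of_int X)"
        unfolding x_def times_divide_eq_right nonzero_mult_div_cancel_left[OF u0] .
    qed (use u in auto)
    define S where "S = (\<Sum>k=0..p-1. of_nat ((3 * k) choose k) * x ^ k)"
    have S: "rat_cong p S (of_int (cubic_seq Y (p + 1)))"
      unfolding S_def by (rule binomial_sum_cong_cubic_seq[OF xD xX XY])
    have "rat_cong p S 1" if "c \<in> C_set 0 p"
    proof -
      obtain q where "eis_prime_above p q" "cubic_type p q 0 r"
        using type[OF \<open>c \<in> C_set 0 p\<close>] by blast
      from eis_prime_above.cubic_seq_type_0[OF this r3 pr Y, of 1]
      have "int p dvd cubic_seq Y (p + 1) - 1" by (simp add: numeral_2_eq_2)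
      then show ?thesis
        using rat_cong_trans[OF S] rat_cong_of_int_iff[of "cubic_seq Y (p + 1)" 1] by simp
    qed
    moreover have "rat_cong p S (- ((1 + c) / (2 * c)))" if "c \<in> C_set 1 p"
    proof -
      obtain q where "eis_prime_above p q" "cubic_type p q 1 r"
        using type[OF \<open>c \<in> C_set 1 p\<close>] by blast
      from eis_prime_above.cubic_seq_type_1(1)[OF this r3 pr Y]
      have "int p dvd 2 * r * cubic_seq Y (p + 1) - (- (1 + r))"
        by (simp only: diff_minus_eq_add)
      moreover have "rat_cong p (- (1 + c)) (of_int (- (1 + r)))"
        using rat_cong_minus[OF rat_cong_add[OF rat_cong_refl[of 1] r(3)]] by simp
      ultimately show ?thesis using clear[OF S] pr by (metis minus_divide_left)
    qed
    moreover have "rat_cong p S ((1 - c) / (2 * c))" if "c \<in> C_set 2 p"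
    proof -
      obtain q where "eis_prime_above p q" "cubic_type p q 2 r"
        using type[OF \<open>c \<in> C_set 2 p\<close>] by blast
      from eis_prime_above.cubic_seq_type_2(1)[OF this r3 pr Y]
      have "int p dvd 2 * r * cubic_seq Y (p + 1) - (1 - r)" .
      moreover have "rat_cong p (1 - c) (of_int (1 - r))"
        using rat_cong_add[OF rat_cong_refl[of 1] rat_cong_minus[OF r(3)]] by simp
      ultimately show ?thesis using clear[OF S] pr by metis
    qed
    ultimately show ?thesis
      unfolding Let_def x_def[symmetric] S_def[symmetric] by blast
  qed
  define x where "x = 4 * c\<^sup>2 / (27 * (c\<^sup>2 + 3))"
  note u = unit[of 27 27, OF _ numerals(3)]
  have u0: "27 * (c\<^sup>2 + 3) \<noteq> 0" using u(1) by auto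
  have xD: "x \<in> D_set p"
    unfolding x_def using u c by (intro D_set_divide) auto
  have xX: "rat_cong p x (of_int X)" if "int p dvd 4 * r\<^sup>2 - 27 * (r\<^sup>2 + 3) * X" for X
  proof (rule rat_cong_cancel)
    have "rat_cong p (4 * c\<^sup>2) (of_int (4 * r\<^sup>2))"
      using rat_cong_mult_left[OF rat_cong_power[OF r(3) c, of 2], of 4] by simp
    also have "rat_cong p (of_int (4 * r\<^sup>2)) (of_int (27 * (r\<^sup>2 + 3)) * of_int X)"
      using rat_cong_of_int_iff[of "4 * r\<^sup>2" "27 * (r\<^sup>2 + 3) * X"] that by simp
    also have "rat_cong p (of_int (27 * (r\<^sup>2 + 3)) * of_int X) (27 * (c\<^sup>2 + 3) * of_int X)"
      using u by (intro rat_cong_mult rat_cong_sym[OF u(2)]) auto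
    finally show "rat_cong p (27 * (c\<^sup>2 + 3) * x) (27 * (c\<^sup>2 + 3) * of_int X)"
      unfolding x_def times_divide_eq_right nonzero_mult_div_cancel_left[OF u0] .
  qed (use u in auto)
  define T where "T = (\<Sum>k=0..p-1. catalan2 k * x ^ k)"
  have "(c \<in> C_set 0 p \<longrightarrow> rat_cong p T 1) \<and>
             (c \<in> C_set 1 p \<longrightarrow> rat_cong p T (- ((9 + c) / (2 * c)))) \<and>
             (c \<in> C_set 2 p \<longrightarrow> rat_cong p T ((9 - c) / (2 * c)))"
  proof (cases "int p dvd r")
    case True
    then have "r = 0" using r(1,2) by (metis zdvd_not_zless order_le_less)
    \<comment> \<open>Only class 0 can contain c here, and the sum reduces to its term at k =
      0.\<close>
    have "omega ^ j = 1" if "c \<in> C_set j p" for j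
      using type[OF that] eis_prime_above.cubic_type_0 \<open>r = 0\<close> by blast
    then have "c \<notin> C_set 1 p" "c \<notin> C_set 2 p"
      using omega_neq_1 by blast+
    moreover have "rat_cong p T 1"
    proof -
      obtain n where n: "p = Suc n" using assms(2) by (cases p) auto
      have "(\<Sum>k<p. w k * 0 ^ k) = (w 0 :: int)" for w
        unfolding n by (subst sum.lessThan_Suc_shift) simp
      then show ?thesis
        using catalan2_sum_cong[OF xD xX[of 0]] \<open>r = 0\<close> by (simp add: T_def)
    qed
    ultimately show ?thesis by blast
  next
    case False
    obtain r1 where r1: "int p dvd r * r1 - 1"
      using ex_inverse_mod[OF False] by blast
    \<comment> \<open>\<open>r'\<close> represents 3 / r; the first sum at \<open>r'\<close> has the
      argument of the second sum at \<open>r\<close>.\<close>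
    define r' where "r' = 3 * r1"
    have rr': "int p dvd r * r' - 3"
    proof -
      have "r * r' - 3 = 3 * (r * r1 - 1)" by (simp add: r'_def)
      then show ?thesis using dvd_mult[OF r1, of 3] by (simp only:)
    qed
    have pr': "\<not> int p dvd r'"
    proof
      assume "int p dvd r'"
      from dvd_diff[OF dvd_mult[OF this, of r] rr'] show False using small by simp
    qed
    have rr'2: "int p dvd r\<^sup>2 * (r'\<^sup>2 + 3) - 3 * (r\<^sup>2 + 3)"
    proof -
      have "r\<^sup>2 * (r'\<^sup>2 + 3) - 3 * (r\<^sup>2 + 3) = (r * r' - 3) * (r * r' + 3)"
        by (simp add: algebra_simps power2_eq_square)
      then show ?thesis using dvd_mult2[OF rr', of "r * r' + 3"] by (simp only:)
    qed
    have r3': "\<not> int p dvd r'\<^sup>2 + 3"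
    proof
      assume "int p dvd r'\<^sup>2 + 3"
      from dvd_diff[OF dvd_mult[OF this, of "r\<^sup>2"] rr'2]
      have "int p dvd 3 * (r\<^sup>2 + 3)" by simp
      then show False using cancel small r3 by blast
    qed
    obtain X Y where XY: "int p dvd X * Y - 1" and Y: "int p dvd 4 * Y - 9 * (r'\<^sup>2 + 3)"
      and X': "int p dvd 9 * (r'\<^sup>2 + 3) * X - 4"
      using ex_reciprocal_pair[of "9 * (r'\<^sup>2 + 3)"] cancel numerals r3' by metis
    have X: "int p dvd 4 * r\<^sup>2 - 27 * (r\<^sup>2 + 3) * X"
    proof -
      have "4 * r\<^sup>2 - 27 * (r\<^sup>2 + 3) * X =
        (r\<^sup>2 * (r'\<^sup>2 + 3) - 3 * (r\<^sup>2 + 3)) * (9 * X) - (9 * (r'\<^sup>2 + 3) * X - 4) * r\<^sup>2"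
        by (simp add: algebra_simps)
      then show ?thesis
        using dvd_diff[OF dvd_mult2[OF rr'2, of "9 * X"] dvd_mult2[OF X', of "r\<^sup>2"]] by (simp only:)
    qed
    have T: "rat_cong p T (of_int (cubic_seq Y (p + 1) - 2 * cubic_seq Y p))"
      unfolding T_def by (rule catalan2_sum_cong_cubic_seq[OF xD xX[OF X] XY])
    have "rat_cong p T 1" if "c \<in> C_set 0 p"
    proof -
      obtain q where q: "eis_prime_above p q" "cubic_type p q 0 r"
        using type[OF \<open>c \<in> C_set 0 p\<close>] by blast
      have "cubic_type p q 0 r'"
        using eis_prime_above.cubic_type_3_div[OF q(1) rr' q(2)] by simp
      note type_0 = eis_prime_above.cubic_seq_type_0[OF q(1) this r3' pr' Y]
      \<comment> \<open>The values come from \<open>cubic_seq Y 2 = 1\<close> and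
        \<open>cubic_seq Y 1 = 0\<close>.\<close>
      have 1: "int p dvd cubic_seq Y (p + 1) - 1" "int p dvd cubic_seq Y p"
        using type_0[of 1] type_0[of 0] by (simp_all add: numeral_2_eq_2)
      have "int p dvd (cubic_seq Y (p + 1) - 1) - 2 * cubic_seq Y p"
        by (rule dvd_diff[OF 1(1) dvd_mult[OF 1(2)]])
      then have "int p dvd (cubic_seq Y (p + 1) - 2 * cubic_seq Y p) - 1"
        by (simp add: algebra_simps)
      then show ?thesis
        using rat_cong_trans[OF T] rat_cong_of_int_iff[of "cubic_seq Y (p + 1) - 2 * cubic_seq Y p" 1]
        by simp
    qed
    moreover have "rat_cong p T (- ((9 + c) / (2 * c)))" if "c \<in> C_set 1 p"
    proof -
      obtain q where q: "eis_prime_above p q" "cubic_type p q 1 r"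
        using type[OF \<open>c \<in> C_set 1 p\<close>] by blast
      have "cubic_type p q 2 r'"
        using eis_prime_above.cubic_type_3_div[OF q(1) rr' q(2)] by (simp add: numeral_2_eq_2)
      note type_2 = eis_prime_above.cubic_seq_type_2[OF q(1) this r3' pr' Y]
      let ?a = "cubic_seq Y (p + 1)" and ?b = "cubic_seq Y p"
      \<comment> \<open>Type 2 gives a - 2 b = - (1 + 3 r') / 2; substituting r' = 3 / r yields - (9
        + r) / (2 r).\<close>
      have "r' * (2 * r * (?a - 2 * ?b) + (9 + r)) =
         r * ((2 * r' * ?a - (1 - r')) - (4 * r' * ?b - (1 + 3 * r'\<^sup>2))) - 3 * r' * (r * r' - 3)"
        by (simp add: algebra_simps power2_eq_square)
      also have "int p dvd \<dots>"
        by (rule dvd_diff[OF dvd_mult[OF dvd_diff[OF type_2]] dvd_mult[OF rr']])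
      finally have "int p dvd 2 * r * (?a - 2 * ?b) + (9 + r)"
        using cancel pr' by blast
      then have "int p dvd 2 * r * (?a - 2 * ?b) - (- (9 + r))"
        by (simp only: diff_minus_eq_add)
      moreover have "rat_cong p (- (9 + c)) (of_int (- (9 + r)))"
        using rat_cong_minus[OF rat_cong_add[OF rat_cong_refl[of 9] r(3)]] by simp
      ultimately show ?thesis using clear[OF T] False by (metis minus_divide_left)
    qed
    moreover have "rat_cong p T ((9 - c) / (2 * c))" if "c \<in> C_set 2 p"
    proof -
      obtain q where q: "eis_prime_above p q" "cubic_type p q 2 r"
        using type[OF \<open>c \<in> C_set 2 p\<close>] by blast
      \<comment> \<open>Doubling the index 2 gives 4, and \<omega>^4 = \<omega>.\<close>
      have "cubic_type p q 1 r'"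
        using eis_prime_above.cubic_type_3_div[OF q(1) rr' q(2)] by (simp add: cubic_type_4)
      note type_1 = eis_prime_above.cubic_seq_type_1[OF q(1) this r3' pr' Y]
      let ?a = "cubic_seq Y (p + 1)" and ?b = "cubic_seq Y p"
      \<comment> \<open>Type 1 gives a - 2 b = (3 r' - 1) / 2, which is (9 - r) / (2 r).\<close>
      have "r' * (2 * r * (?a - 2 * ?b) - (9 - r)) =
         r * ((2 * r' * ?a + (1 + r')) - (4 * r' * ?b + (1 + 3 * r'\<^sup>2))) + 3 * r' * (r * r' - 3)"
        by (simp add: algebra_simps power2_eq_square)
      also have "int p dvd \<dots>"
        by (rule dvd_add[OF dvd_mult[OF dvd_diff[OF type_1]] dvd_mult[OF rr']])
      finally have "int p dvd 2 * r * (?a - 2 * ?b) - (9 - r)"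
        using cancel pr' by blast
      moreover have "rat_cong p (9 - c) (of_int (9 - r))"
        using rat_cong_add[OF rat_cong_refl[of 9] rat_cong_minus[OF r(3)]] by simp
      ultimately show ?thesis using clear[OF T] False by metis
    qed
    ultimately show ?thesis by blast
  qed
  then show ?thesis
    using part1 unfolding Let_def x_def[symmetric] T_def[symmetric] by blast
qed

end
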